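(* Let $\theta$ be an inner function. The conjugations $X$ on $K_\theta$ satisfying both $S_\theta^*X=XS_\theta$ and $S_\theta X=XS_\theta^*$ are exactly those of the form $X=\lambda C_\theta$, where $\lambda$ is a unimodular constant.
   Context: $H^2$ is the Hardy–Hilbert space of the unit disk, identified via boundary values with a closed subspace of $L^2=L^2(\mathbb{T})$. For an inner function $\theta$, the model space is $K_\theta=H^2\ominus\theta H^2$. The compressed shift is $S_\theta:K_\theta\to K_\theta$, $S_\theta f=P_\theta(zf)$, where $P_\theta$ is the orthogonal projection of $L^2$ onto $K_\theta$. A conjugation on a complex Hilbert space $\mathcal{H}$ is an antilinear map $C:\mathcal{H}\to\mathcal{H}$ such that $\langle Cf, Cg\rangle = \langle g,f\rangle$ and $C^2h=h$ for all $f,g,h\in\mathcal{H}$. The map $C_\theta:K_\theta\to K_\theta$ is the conjugation given on $\mathbb{T}$ by $C_\theta(f)=\theta\,\bar z\,\bar f$. *)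

theory Defs
  imports "HOL-Complex_Analysis.Complex_Analysis"
begin

section \<open>The space $L^2$ of the unit circle\<close>

text \<open>Normalised arc length, as a Borel probability measure whose underlying space is the circle.\<close>

definition circle_measure :: "complex measure" where
  "circle_measure =
     distr (uniform_measure lborel {0..<2 * pi}) (restrict_space borel (sphere 0 1)) cis"

definition square_integrable :: "(complex \<Rightarrow> complex) \<Rightarrow> bool" where
  "square_integrable f \<longleftrightarrow>
     f \<in> borel_measurable circle_measure \<and> integrable circle_measure (\<lambda>z. (cmod (f z))\<^sup>2)"

definition l2_rel :: "(complex \<Rightarrow> complex) \<Rightarrow> (complex \<Rightarrow> complex) \<Rightarrow> bool" where
  "l2_rel f g \<longleftrightarrow>
     square_integrable f \<and> square_integrable g \<and> (AE z in circle_measure. f z = g z)"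

lemma square_integrable_zero: "square_integrable (\<lambda>_. 0)"
  by (simp add: square_integrable_def)

lemma square_integrable_cmult:
  assumes "square_integrable f"
  shows "square_integrable (\<lambda>z. c * f z)"
  using assms by (auto simp: square_integrable_def norm_mult power_mult_distrib)

lemma square_integrable_add:
  assumes "square_integrable f" and "square_integrable g"
  shows "square_integrable (\<lambda>z. f z + g z)"
proof -
  have [measurable]: "f \<in> borel_measurable circle_measure" "g \<in> borel_measurable circle_measure"
    using assms by (auto simp: square_integrable_def)
  have "integrable circle_measure (\<lambda>z. 2 * (cmod (f z))\<^sup>2 + 2 * (cmod (g z))\<^sup>2)"
    using assms by (auto simp: square_integrable_def)
  then have "integrable circle_measure (\<lambda>z. (cmod (f z + g z))\<^sup>2)"
  proof (rule Bochner_Integration.integrable_bound)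
    show "AE z in circle_measure. norm ((cmod (f z + g z))\<^sup>2)
        \<le> norm (2 * (cmod (f z))\<^sup>2 + 2 * (cmod (g z))\<^sup>2)"
    proof (rule AE_I2)
      fix z
      have "(cmod (f z + g z))\<^sup>2 \<le> (cmod (f z) + cmod (g z))\<^sup>2"
        by (intro power_mono norm_triangle_ineq) auto
      also have "\<dots> \<le> 2 * (cmod (f z))\<^sup>2 + 2 * (cmod (g z))\<^sup>2"
        using sum_squares_bound[of "cmod (f z)" "cmod (g z)"] by (simp add: power2_sum)
      finally show "norm ((cmod (f z + g z))\<^sup>2)
          \<le> norm (2 * (cmod (f z))\<^sup>2 + 2 * (cmod (g z))\<^sup>2)"
        by simp
    qed
  qed measurable
  then show ?thesis
    by (simp add: square_integrable_def)
qed

quotient_type l2 = "complex \<Rightarrow> complex" / partial: l2_rel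
proof (rule part_equivpI)
  show "\<exists>f. l2_rel f f"
    by (rule exI[of _ "\<lambda>_. 0"]) (simp add: l2_rel_def square_integrable_zero)
  show "symp l2_rel"
    by (auto simp: symp_def l2_rel_def elim: AE_mp)
  show "transp l2_rel"
    unfolding transp_def l2_rel_def by (auto elim!: AE_mp)
qed

instantiation l2 :: ab_group_add
begin

lift_definition zero_l2 :: l2 is "\<lambda>_. 0"
  by (simp add: l2_rel_def square_integrable_zero)

lift_definition plus_l2 :: "l2 \<Rightarrow> l2 \<Rightarrow> l2" is "\<lambda>f g z. f z + g z"
  unfolding l2_rel_def by (auto intro: square_integrable_add elim!: AE_mp)

lift_definition uminus_l2 :: "l2 \<Rightarrow> l2" is "\<lambda>f z. - f z"
  unfolding l2_rel_def
  using square_integrable_cmult[where c = "-1"] by (auto elim!: AE_mp)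

definition minus_l2 :: "l2 \<Rightarrow> l2 \<Rightarrow> l2" where
  "minus_l2 f g = f + - g"

instance
proof
  fix f g h :: l2
  show "f + g + h = f + (g + h)"
    by transfer (auto simp: l2_rel_def add.assoc intro!: square_integrable_add)
  show "f + g = g + f"
    by transfer (auto simp: l2_rel_def add.commute intro!: square_integrable_add)
  show "0 + f = f"
    by transfer (auto simp: l2_rel_def)
  show "- f + f = 0"
    by transfer (auto simp: l2_rel_def square_integrable_zero)
  show "f - g = f + - g"
    by (simp add: minus_l2_def)
qed

end

lift_definition scaleC :: "complex \<Rightarrow> l2 \<Rightarrow> l2" (infixr "*\<^sub>C" 75) is "\<lambda>c f z. c * f z"
  unfolding l2_rel_def by (auto intro: square_integrable_cmult elim!: AE_mp)

text \<open>Linear in the first argument.\<close>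

lift_definition cinner :: "l2 \<Rightarrow> l2 \<Rightarrow> complex" is
  "\<lambda>f g. integral\<^sup>L circle_measure (\<lambda>z. f z * cnj (g z))"
proof -
  have *: "(\<lambda>z. f z * cnj (g z)) \<in> borel_measurable circle_measure"
    if "square_integrable f" "square_integrable g" for f g
  proof -
    have [measurable]: "f \<in> borel_measurable circle_measure" "g \<in> borel_measurable circle_measure"
      using that by (auto simp: square_integrable_def)
    have [measurable]: "cnj \<in> borel_measurable borel"
      by (intro borel_measurable_continuous_onI continuous_intros)
    show ?thesis
      by measurable
  qed
  show "integral\<^sup>L circle_measure (\<lambda>z. f z * cnj (g z)) =
        integral\<^sup>L circle_measure (\<lambda>z. f' z * cnj (g' z))"
    if "l2_rel f f'" "l2_rel g g'" for f f' g g'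
    using that by (intro integral_cong_AE *) (auto simp: l2_rel_def elim!: AE_mp)
qed

text \<open>
  The element of \<^typ>\<open>l2\<close> represented by a function is \<^const>\<open>abs_l2\<close> of it, meaningful only for
  square-integrable functions; \<^const>\<open>rep_l2\<close> chooses a representative, which is determined only
  almost everywhere.
\<close>

definition mult_l2 :: "(complex \<Rightarrow> complex) \<Rightarrow> l2 \<Rightarrow> l2" where
  "mult_l2 \<phi> f = abs_l2 (\<lambda>z. \<phi> z * rep_l2 f z)"


section \<open>Operators on subspaces of $L^2$\<close>

text \<open>
  A map on a subspace \<open>H\<close> is represented by a function on all of \<^typ>\<open>l2\<close>, whose values
  outside \<open>H\<close> are irrelevant.
\<close>

definition orth_proj :: "l2 set \<Rightarrow> l2 \<Rightarrow> l2" where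
  "orth_proj H f = (THE g. g \<in> H \<and> (\<forall>h\<in>H. cinner (f - g) h = 0))"

definition adjoint_on :: "l2 set \<Rightarrow> (l2 \<Rightarrow> l2) \<Rightarrow> l2 \<Rightarrow> l2" where
  "adjoint_on H T g = (THE h. h \<in> H \<and> (\<forall>f\<in>H. cinner (T f) g = cinner f h))"

definition conjugation_on :: "l2 set \<Rightarrow> (l2 \<Rightarrow> l2) \<Rightarrow> bool" where
  "conjugation_on H C \<longleftrightarrow>
     (\<forall>f\<in>H. C f \<in> H) \<and>
     (\<forall>f\<in>H. \<forall>g\<in>H. C (f + g) = C f + C g) \<and>
     (\<forall>a. \<forall>f\<in>H. C (a *\<^sub>C f) = cnj a *\<^sub>C C f) \<and>
     (\<forall>f\<in>H. \<forall>g\<in>H. cinner (C f) (C g) = cinner g f) \<and>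
     (\<forall>h\<in>H. C (C h) = h)"


section \<open>Hardy space, inner functions and model spaces\<close>

definition hardy_disk :: "(complex \<Rightarrow> complex) set" where
  "hardy_disk = {F. F holomorphic_on ball 0 1 \<and>
     (\<exists>B. \<forall>r\<in>{0..<1}. integral\<^sup>L circle_measure (\<lambda>z. (cmod (F (of_real r * z)))\<^sup>2) \<le> B)}"

text \<open>The Hardy space as the subspace of $L^2$ of radial boundary values.\<close>

definition H2 :: "l2 set" where
  "H2 = {f. \<exists>F\<in>hardy_disk. AE z in circle_measure.
     ((\<lambda>r. F (of_real r * z)) \<longlongrightarrow> rep_l2 f z) (at_left (1::real))}"

definition inner_function :: "(complex \<Rightarrow> complex) \<Rightarrow> bool" where
  "inner_function \<theta> \<longleftrightarrow>
     \<theta> holomorphic_on ball 0 1 \<and> bounded (\<theta> ` ball 0 1) \<and>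
     (AE z in circle_measure.
        \<exists>w. cmod w = 1 \<and> ((\<lambda>r. \<theta> (of_real r * z)) \<longlongrightarrow> w) (at_left (1::real)))"

definition boundary_fun :: "(complex \<Rightarrow> complex) \<Rightarrow> complex \<Rightarrow> complex" where
  "boundary_fun F z = Lim (at_left (1::real)) (\<lambda>r. F (of_real r * z))"

definition model_space :: "(complex \<Rightarrow> complex) \<Rightarrow> l2 set" where
  "model_space \<theta> = {f \<in> H2. \<forall>g \<in> mult_l2 (boundary_fun \<theta>) ` H2. cinner f g = 0}"

definition compressed_shift :: "(complex \<Rightarrow> complex) \<Rightarrow> l2 \<Rightarrow> l2" where
  "compressed_shift \<theta> f = orth_proj (model_space \<theta>) (mult_l2 (\<lambda>z. z) f)"

definition compressed_shift_adj :: "(complex \<Rightarrow> complex) \<Rightarrow> l2 \<Rightarrow> l2" where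
  "compressed_shift_adj \<theta> = adjoint_on (model_space \<theta>) (compressed_shift \<theta>)"

definition model_conj :: "(complex \<Rightarrow> complex) \<Rightarrow> l2 \<Rightarrow> l2" where
  "model_conj \<theta> f = abs_l2 (\<lambda>z. boundary_fun \<theta> z * cnj z * cnj (rep_l2 f z))"

end

theory Submission
  imports Defs
begin

text \<open>
  Write \<open>e n\<close> for the function \<open>z\<^sup>n\<close> on the circle (\<open>n\<close> any integer) and \<open>t n\<close> for \<open>\<theta>\<close> times
  \<open>e n\<close>. The proof lives on these two orthonormal families. The model space consists of the
  elements of \<open>L\<^sup>2\<close> that are orthogonal to \<open>e n\<close> for \<open>n < 0\<close> and to \<open>t n\<close> for \<open>n \<ge> 0\<close>
  (\<open>model_space_iff\<close>), and the model conjugation maps \<open>e n\<close> to \<open>t (- n - 1)\<close> and back, so it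
  preserves this space. On the model space the compressed shift \<open>S\<close> is multiplication by \<open>z\<close>
  followed by removal of the \<open>t 0\<close> component, and its adjoint \<open>S\<^sup>*\<close> is the backward shift: remove
  the constant term and divide by \<open>z\<close>. With these formulas, the fact that the conjugation \<open>C\<close>
  intertwines \<open>S\<close> and \<open>S\<^sup>*\<close> is a one-line computation (\<open>backward_shift_model_conj\<close>), which
  settles the direction from right to left.

  For the converse, let \<open>X\<close> be a conjugation with both intertwining relations. Then the linear map
  \<open>U = X C\<close> commutes with \<open>S\<close> and with \<open>S\<^sup>*\<close>, hence with \<open>I - S S\<^sup>*\<close>. That operator has rank at
  most one: it sends \<open>f\<close> to \<open>f(0) k\<close>, where \<open>k\<close> is the reproducing kernel at the origin. Therefore
  \<open>(U f)(0) = \<lambda> f(0)\<close> for a constant \<open>\<lambda>\<close>, and since the \<open>n\<close>-th Fourier coefficient of \<open>f\<close> is the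
  zeroth coefficient of \<open>(S\<^sup>*)\<^sup>n f\<close>, all coefficients of \<open>U f\<close> are \<open>\<lambda>\<close> times those of \<open>f\<close>
  (\<open>commutant_scalar\<close>). So \<open>U\<close> is \<open>\<lambda>\<close> times the identity, which gives \<open>X = \<lambda> C\<close>; since \<open>X\<close> and
  \<open>C\<close> preserve norms, \<open>\<lambda>\<close> is unimodular unless the model space is zero.

  The analytic work is the description of the Hardy space by Fourier coefficients (\<open>H2_iff\<close>),
  because \<^const>\<open>H2\<close> is defined through radial boundary values. That boundary functions have no negative
  frequencies follows from a weak limit of dilates (\<open>weakly_null\<close>, \<open>hardy_orthogonal\<close>). The
  other inclusion is Fatou's theorem: the Poisson integral of an integrable function converges
  radially almost everywhere (\<open>poisson_tendsto_AE\<close>). It is proved at Lebesgue points, by slicing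
  the Poisson kernel into arcs (\<open>layer_cake_bound\<close>). It also shows that an integrable function is
  determined by its Fourier coefficients.
\<close>

section \<open>Integration over the circle\<close>

lemma measurable_uniform_eq:
  "measurable (uniform_measure lborel A) N = measurable borel N"
  by (rule measurable_cong_sets) auto

lemma cis_measurable_circle:
  "cis \<in> measurable (uniform_measure lborel {0..<2 * pi}) (restrict_space borel (sphere 0 1))"
proof -
  have "cis \<in> borel_measurable borel"
    by (intro borel_measurable_continuous_onI continuous_intros)
  then show ?thesis
    by (auto intro!: measurable_restrict_space2 simp: measurable_uniform_eq)
qed

lemma space_circle: "space circle_measure = sphere 0 1"
  by (simp add: circle_measure_def space_restrict_space)

lemma sets_circle: "sets circle_measure = sets (restrict_space borel (sphere 0 1))"
  by (simp add: circle_measure_def)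

lemma emeasure_circle_space: "emeasure circle_measure (space circle_measure) = 1"
proof -
  have "cis -` sphere 0 1 \<inter> {0..<2 * pi} = {0..<2 * pi}" by auto
  then have "emeasure circle_measure (sphere 0 1) = 1"
    unfolding circle_measure_def
    by (subst emeasure_distr[OF cis_measurable_circle])
       (auto simp: sets_restrict_space_iff vimage_def emeasure_uniform_measure
          divide_ennreal ennreal_1[symmetric] simp del: ennreal_1)
  then show ?thesis by (simp add: space_circle)
qed

lemma measurable_circle_eq:
  "measurable circle_measure N = measurable (restrict_space borel (sphere 0 1)) N"
  by (rule measurable_cong_sets[OF sets_circle refl])

interpretation circle: finite_measure circle_measure
  by (rule finite_measureI) (simp add: emeasure_circle_space)

lemma measure_circle_space: "measure circle_measure (space circle_measure) = 1"
  by (simp add: measure_def emeasure_circle_space)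

lemma borel_measurable_circle:
  "f \<in> borel_measurable borel \<Longrightarrow> f \<in> borel_measurable circle_measure"
  unfolding measurable_circle_eq by (rule measurable_restrict_space1)

lemma borel_measurable_cnj [measurable]: "cnj \<in> borel_measurable borel"
  by (intro borel_measurable_continuous_onI continuous_intros)

lemma measurable_cnj [measurable]:
  "f \<in> borel_measurable M \<Longrightarrow> (\<lambda>x. cnj (f x)) \<in> borel_measurable M"
  by measurable

lemma borel_measurable_powi [measurable]:
  "f \<in> borel_measurable M \<Longrightarrow> (\<lambda>x. (f x :: complex) powi n) \<in> borel_measurable M"
  unfolding power_int_def by (cases "n \<ge> 0") auto

lemma measurable_comp_cis:
  assumes "f \<in> borel_measurable circle_measure"
  shows "(\<lambda>t. f (cis t)) \<in> borel_measurable borel"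
proof -
  have "(\<lambda>t. f (cis t)) \<in> borel_measurable (uniform_measure lborel {0..<2 * pi})"
    using measurable_compose[OF cis_measurable_circle] assms
    by (simp add: measurable_circle_eq)
  then show ?thesis
    by (simp add: measurable_uniform_eq)
qed

lemma uniform_circle_density:
  "uniform_measure lborel {0..<2 * pi} =
    density lborel (\<lambda>t. ennreal (indicator {0..<2 * pi} t / (2 * pi)))"
  unfolding uniform_measure_def
  by (intro density_cong) (auto simp: indicator_def ennreal_1[symmetric] divide_ennreal simp del: ennreal_1)

lemma integrable_circle_iff:
  fixes f :: "complex \<Rightarrow> 'b::{banach, second_countable_topology}"
  assumes "f \<in> borel_measurable circle_measure"
  shows "integrable circle_measure f \<longleftrightarrow> set_integrable lborel {0..<2 * pi} (\<lambda>t. f (cis t))"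
proof -
  note [measurable] = measurable_comp_cis[OF assms]
  have "integrable circle_measure f \<longleftrightarrow>
        integrable (uniform_measure lborel {0..<2 * pi}) (\<lambda>t. f (cis t))"
    unfolding circle_measure_def
    using assms by (intro integrable_distr_eq[OF cis_measurable_circle])
      (simp add: measurable_circle_eq)
  also have "\<dots> \<longleftrightarrow> integrable lborel (\<lambda>t. (indicator {0..<2 * pi} t / (2 * pi)) *\<^sub>R f (cis t))"
    unfolding uniform_circle_density by (intro integrable_density) auto
  also have "(\<lambda>t. (indicator {0..<2 * pi} t / (2 * pi)) *\<^sub>R f (cis t)) =
       (\<lambda>t. (1 / (2 * pi)) *\<^sub>R (indicator {0..<2 * pi} t *\<^sub>R f (cis t)))"
    by auto
  also have "integrable lborel \<dots> \<longleftrightarrow> set_integrable lborel {0..<2 * pi} (\<lambda>t. f (cis t))"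
  proof
    let ?g = "\<lambda>t. indicator {0..<2 * pi} t *\<^sub>R f (cis t)"
    assume "integrable lborel (\<lambda>t. (1 / (2 * pi)) *\<^sub>R ?g t)"
    then have "integrable lborel (\<lambda>t. (2 * pi) *\<^sub>R ((1 / (2 * pi)) *\<^sub>R ?g t))"
      by (rule integrable_scaleR_right)
    then show "set_integrable lborel {0..<2 * pi} (\<lambda>t. f (cis t))"
      unfolding set_integrable_def by simp
  next
    assume "set_integrable lborel {0..<2 * pi} (\<lambda>t. f (cis t))"
    then show "integrable lborel (\<lambda>t. (1 / (2 * pi)) *\<^sub>R (indicator {0..<2 * pi} t *\<^sub>R f (cis t)))"
      unfolding set_integrable_def by (intro integrable_scaleR_right)
  qed
  finally show ?thesis .
qed

lemma integral_circle:
  fixes f :: "complex \<Rightarrow> 'b::{banach, second_countable_topology}"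
  assumes "f \<in> borel_measurable circle_measure"
  shows "integral\<^sup>L circle_measure f =
    (1 / (2 * pi)) *\<^sub>R set_lebesgue_integral lborel {0..<2 * pi} (\<lambda>t. f (cis t))"
proof -
  note [measurable] = measurable_comp_cis[OF assms]
  have "integral\<^sup>L circle_measure f =
        integral\<^sup>L (uniform_measure lborel {0..<2 * pi}) (\<lambda>t. f (cis t))"
    unfolding circle_measure_def
    using assms by (intro integral_distr[OF cis_measurable_circle])
      (simp add: measurable_circle_eq)
  also have "\<dots> = integral\<^sup>L lborel (\<lambda>t. (indicator {0..<2 * pi} t / (2 * pi)) *\<^sub>R f (cis t))"
    unfolding uniform_circle_density by (intro integral_density) auto
  also have "(\<lambda>t. (indicator {0..<2 * pi} t / (2 * pi)) *\<^sub>R f (cis t)) =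
       (\<lambda>t. (1 / (2 * pi)) *\<^sub>R (indicator {0..<2 * pi} t *\<^sub>R f (cis t)))"
    by auto
  finally show ?thesis
    unfolding set_lebesgue_integral_def by (simp only: integral_scaleR_right)
qed

lemma borel_measurable_Arg2pi: "Arg2pi \<in> borel_measurable borel"
  unfolding borel_measurable_iff_le using closed_Arg2pi2pi_le by (auto intro: borel_closed)

lemma cis_Arg2pi_unit: "cmod z = 1 \<Longrightarrow> cis (Arg2pi z) = z"
  by (metis cis_conv_exp complex_norm_eq_1_exp)

lemma Arg2pi_cis: "0 \<le> t \<Longrightarrow> t < 2 * pi \<Longrightarrow> Arg2pi (cis t) = t"
  by (rule Arg2pi_unique[of 1]) (auto simp: cis_conv_exp)

text \<open>The branch \<^const>\<open>Arg2pi\<close> is a Borel inverse of the parametrisation; it turns a Borel null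
  set of parameters into a Borel null set of the circle, so the exceptional set need not be
  examined.\<close>

lemma AE_circleI:
  assumes "AE t in lborel. t \<in> {0..<2 * pi} \<longrightarrow> P (cis t)"
  shows "AE z in circle_measure. P z"
proof -
  obtain N where N: "{t \<in> space lborel. \<not> (t \<in> {0..<2 * pi} \<longrightarrow> P (cis t))} \<subseteq> N"
      "emeasure lborel N = 0" "N \<in> sets lborel"
    using AE_E[OF assms] by blast
  define Z where "Z = {z \<in> space circle_measure. Arg2pi z \<in> N}"
  have Arg: "Arg2pi \<in> borel_measurable circle_measure"
    by (rule borel_measurable_circle[OF borel_measurable_Arg2pi])
  have N': "N \<in> sets borel" using N(3) by simp
  have Z: "Z \<in> sets circle_measure"
    using measurable_sets[OF Arg N'] unfolding Z_def vimage_def by (simp add: Int_def conj_commute)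
  have "emeasure circle_measure Z =
      emeasure (uniform_measure lborel {0..<2 * pi}) (cis -` Z \<inter> space (uniform_measure lborel {0..<2 * pi}))"
    unfolding circle_measure_def
    by (rule emeasure_distr[OF cis_measurable_circle]) (use Z sets_circle in auto)
  also have "\<dots> = 0"
  proof -
    have "cis \<in> borel_measurable borel"
      by (intro borel_measurable_continuous_onI continuous_intros)
    have cZ: "cis -` Z \<in> sets borel"
      using measurable_sets[OF cis_measurable_circle, of Z] Z by (simp add: sets_circle)
    have "emeasure lborel ({0..<2 * pi} \<inter> cis -` Z) \<le> emeasure lborel N"
      using N(3) by (intro emeasure_mono) (auto simp: Z_def Arg2pi_cis)
    then show ?thesis
      using cZ N(2) by (simp add: emeasure_uniform_measure)
  qed
  finally have "Z \<in> null_sets circle_measure" using Z by auto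
  moreover have "{z \<in> space circle_measure. \<not> P z} \<subseteq> Z"
  proof
    fix z assume z: "z \<in> {z \<in> space circle_measure. \<not> P z}"
    then have "cmod z = 1" by (simp add: space_circle)
    then have "cis (Arg2pi z) = z" by (rule cis_Arg2pi_unit)
    moreover have "Arg2pi z \<in> {0..<2 * pi}" using Arg2pi[of z] by auto
    ultimately have "Arg2pi z \<in> N" using N(1) z by auto
    then show "z \<in> Z" using z by (simp add: Z_def)
  qed
  ultimately show ?thesis by (rule AE_I')
qed

lemma AE_circle_norm: "AE z in circle_measure. cmod z = 1"
  by (rule AE_I2) (simp add: space_circle)

lemma integral_circle_powi: "(\<integral>z. z powi n \<partial>circle_measure) = (if n = 0 then 1 else 0)"
proof (cases "n = 0")
  case True
  then show ?thesis using measure_circle_space by simp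
next
  case False
  have "((\<lambda>t. cis (of_int n * t) / (\<i> * of_int n)) has_vector_derivative cis (of_int n * t))
          (at t within {0..2*pi})" for t
  proof -
    have "((\<lambda>t. cis (of_int n * t) / (\<i> * of_int n)) has_vector_derivative
        ((of_int n * \<i>) * cis (of_int n * t)) / (\<i> * of_int n)) (at t within {0..2*pi})"
    proof -
      have "((\<lambda>z. exp (\<i> * (of_int n * z)) / (\<i> * of_int n)) has_field_derivative
          ((of_int n * \<i>) * exp (\<i> * (of_int n * of_real t))) / (\<i> * of_int n)) (at (of_real t))"
        by (rule derivative_eq_intros refl | simp add: False mult.left_commute[of \<i>] mult.commute[of _ \<i>])+
      then show ?thesis
        unfolding cis_conv_exp using has_vector_derivative_real_field by fastforce
    qed
    then show ?thesis using False by simp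
  qed
  then have "((\<lambda>t. cis (of_int n * t)) has_integral
      (cis (of_int n * (2 * pi)) / (\<i> * of_int n) - cis (of_int n * 0) / (\<i> * of_int n))) {0..2*pi}"
    by (intro fundamental_theorem_of_calculus) auto
  moreover have "cis (of_int n * (2 * pi)) = 1"
    using cis_multiple_2pi[of "of_int n"] by (simp add: mult.commute)
  ultimately have hi: "((\<lambda>t. cis (of_int n * t)) has_integral 0) {0..2*pi}" by simp
  have "set_lebesgue_integral lborel {0..<2 * pi} (\<lambda>t. cis t powi n)
      = set_lebesgue_integral lborel {0..2 * pi} (\<lambda>t. cis t powi n)"
    unfolding set_lebesgue_integral_def
  proof (rule integral_cong_AE)
    have "(\<lambda>t. cis t powi n) \<in> borel_measurable borel"
      unfolding cis_power_int by (intro borel_measurable_continuous_onI continuous_intros)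
    then show "(\<lambda>t. indicator {0..<2 * pi} t *\<^sub>R cis t powi n) \<in> borel_measurable lborel"
        "(\<lambda>t. indicator {0..2 * pi} t *\<^sub>R cis t powi n) \<in> borel_measurable lborel"
      by simp_all
    show "AE t in lborel. indicator {0..<2 * pi} t *\<^sub>R cis t powi n =
        indicator {0..2 * pi} t *\<^sub>R cis t powi n"
      using AE_lborel_singleton[of "2*pi"] by eventually_elim (auto simp: indicator_def)
  qed
  also have "\<dots> = integral {0..2*pi} (\<lambda>t. cis t powi n)"
  proof (rule set_borel_integral_eq_integral)
    show "set_integrable lborel {0..2*pi} (\<lambda>t. cis t powi n)"
      by (rule borel_integrable_atLeastAtMost') (auto intro!: continuous_intros simp: cis_power_int)
  qed
  also have "\<dots> = 0"
    using hi by (simp add: cis_power_int integral_unique)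
  finally show ?thesis using False
    by (subst integral_circle) (auto intro!: borel_measurable_circle)
qed

section \<open>Lebesgue points and the layer-cake estimate\<close>

text \<open>Lebesgue's differentiation theorem. The exceptional set is negligible for the completed
  measure, hence contained in a Borel null set.\<close>

lemma right_averages_tendsto:
  fixes f :: "real \<Rightarrow> complex"
  assumes f: "integrable lborel f"
  shows "AE x in lborel. \<forall>e>0. \<exists>d>0. \<forall>h. 0 < h \<and> h < d \<longrightarrow>
    cmod (set_lebesgue_integral lborel {x..x+h} f - of_real h * f x) \<le> e * h"
proof -
  have si: "set_integrable lborel {a..b} f" for a b
    unfolding set_integrable_def by (rule integrable_mult_indicator) (use f in auto)
  obtain N where N: "negligible N"
    and D: "\<And>x e. \<lbrakk>x \<notin> N; 0 < e\<rbrakk> \<Longrightarrow> \<exists>d>0. \<forall>h. 0 < h \<and> h < d \<longrightarrow>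
        norm (integral (cbox x (x + h *\<^sub>R One)) f /\<^sub>R h ^ DIM(real) - f x) < e"
    using integrable_ccontinuous_explicit[of f] si set_borel_integral_eq_integral(1) by (metis cbox_interval)
  have "AE x in lborel. x \<notin> N"
    using N unfolding negligible_iff_null_sets by (metis AE_completion_iff AE_not_in)
  then show ?thesis
  proof eventually_elim
    fix x assume x: "x \<notin> N"
    show "\<forall>e>0. \<exists>d>0. \<forall>h. 0 < h \<and> h < d \<longrightarrow>
      cmod (set_lebesgue_integral lborel {x..x+h} f - of_real h * f x) \<le> e * h"
    proof (intro allI impI)
      fix e :: real assume "e > 0"
      then obtain d where d: "d > 0" "\<And>h. 0 < h \<and> h < d \<Longrightarrow>
          norm (integral (cbox x (x + h *\<^sub>R One)) f /\<^sub>R h ^ DIM(real) - f x) < e"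
        using D[OF x] by blast
      have "cmod (set_lebesgue_integral lborel {x..x+h} f - of_real h * f x) \<le> e * h"
        if h: "0 < h" "h < d" for h
      proof -
        let ?I = "set_lebesgue_integral lborel {x..x+h} f"
        have "norm (?I /\<^sub>R h - f x) < e"
          using d(2)[of h] h si set_borel_integral_eq_integral(2)[OF si] by simp
        then have "h * norm (?I /\<^sub>R h - f x) \<le> e * h"
          using h by (simp add: mult.commute)
        moreover have "h * norm (?I /\<^sub>R h - f x) = norm (h *\<^sub>R (?I /\<^sub>R h - f x))"
          using h by simp
        moreover have "h *\<^sub>R (?I /\<^sub>R h - f x) = ?I - of_real h * f x"
          using h by (simp add: scaleR_diff_right scaleR_conv_of_real[of h "f x"])
        ultimately show ?thesis by simp
      qed
      with d(1) show "\<exists>d>0. \<forall>h. 0 < h \<and> h < d \<longrightarrow>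
        cmod (set_lebesgue_integral lborel {x..x+h} f - of_real h * f x) \<le> e * h" by blast
    qed
  qed
qed

text \<open>Averages over centred intervals combine the one-sided averages of the function and of its
  reflection.\<close>

lemma symmetric_averages_tendsto:
  fixes f :: "real \<Rightarrow> complex"
  assumes f: "integrable lborel f"
  shows "AE x in lborel. \<forall>e>0. \<exists>d>0. \<forall>h. 0 < h \<and> h < d \<longrightarrow>
    cmod (set_lebesgue_integral lborel {x-h..x+h} f - of_real (2 * h) * f x) \<le> e * (2 * h)"
proof -
  define g where "g = (\<lambda>x. f (- x))"
  have g: "integrable lborel g"
    unfolding g_def using lborel_integrable_real_affine[OF f, of "-1" 0] by simp
  define Q where "Q = (\<lambda>x. \<forall>e>0. \<exists>d>0. \<forall>h. 0 < h \<and> h < d \<longrightarrow>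
    cmod (set_lebesgue_integral lborel {x..x+h} g - of_real h * g x) \<le> e * h)"
  have "AE x in lborel. Q x" unfolding Q_def by (rule right_averages_tendsto[OF g])
  then have "AE x in distr lborel borel (\<lambda>x::real. - x). Q x"
    by (subst lborel_distr_uminus)
  then have Qm: "AE x in lborel. Q (- x)"
    by (rule AE_distrD[rotated]) simp
  show ?thesis
    using right_averages_tendsto[OF f] Qm
  proof eventually_elim
    fix x
    assume R: "\<forall>e>0. \<exists>d>0. \<forall>h. 0 < h \<and> h < d \<longrightarrow>
        cmod (set_lebesgue_integral lborel {x..x+h} f - of_real h * f x) \<le> e * h"
      and L: "Q (- x)"
    show "\<forall>e>0. \<exists>d>0. \<forall>h. 0 < h \<and> h < d \<longrightarrow>
      cmod (set_lebesgue_integral lborel {x-h..x+h} f - of_real (2 * h) * f x) \<le> e * (2 * h)"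
    proof (intro allI impI)
      fix e :: real assume e: "e > 0"
      obtain d1 where d1: "d1 > 0" "\<And>h. 0 < h \<and> h < d1 \<Longrightarrow>
          cmod (set_lebesgue_integral lborel {x..x+h} f - of_real h * f x) \<le> e * h"
        using R e by blast
      obtain d2 where d2: "d2 > 0" "\<And>h. 0 < h \<and> h < d2 \<Longrightarrow>
          cmod (set_lebesgue_integral lborel {-x..-x+h} g - of_real h * g (-x)) \<le> e * h"
        using L e unfolding Q_def by blast
      have "cmod (set_lebesgue_integral lborel {x-h..x+h} f - of_real (2 * h) * f x) \<le> e * (2 * h)"
        if h: "0 < h" "h < min d1 d2" for h
      proof -
        have si: "set_integrable lborel {a..b} f" for a b
          unfolding set_integrable_def by (rule integrable_mult_indicator) (use f in auto)
        have left: "set_lebesgue_integral lborel {-x..-x+h} g = set_lebesgue_integral lborel {x-h..x} f"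
        proof -
          have "set_lebesgue_integral lborel {x-h..x} f =
            \<bar>-1\<bar> *\<^sub>R (\<integral>t. indicator {x-h..x} (0 + -1 * t) *\<^sub>R f (0 + -1 * t) \<partial>lborel)"
            unfolding set_lebesgue_integral_def by (rule lborel_integral_real_affine) simp
          also have "\<dots> = set_lebesgue_integral lborel {-x..-x+h} g"
            unfolding set_lebesgue_integral_def g_def
            by (auto intro!: Bochner_Integration.integral_cong simp: indicator_def)
          finally show ?thesis by simp
        qed
        have "set_lebesgue_integral lborel {x-h..x+h} f =
            set_lebesgue_integral lborel ({x-h..x} \<union> {x..x+h}) f"
          using h by (intro arg_cong[where f = "\<lambda>A. set_lebesgue_integral lborel A f"]) auto
        also have "\<dots> = set_lebesgue_integral lborel {x-h..x} f + set_lebesgue_integral lborel {x..x+h} f"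
        proof (rule set_integral_Un_AE)
          show "AE t in lborel. \<not> (t \<in> {x-h..x} \<and> t \<in> {x..x+h})"
            using AE_lborel_singleton[of x] by eventually_elim auto
        qed (use si in auto)
        finally have "set_lebesgue_integral lborel {x-h..x+h} f - of_real (2 * h) * f x =
            (set_lebesgue_integral lborel {-x..-x+h} g - of_real h * g (-x)) +
            (set_lebesgue_integral lborel {x..x+h} f - of_real h * f x)"
          by (subst left) (simp add: g_def algebra_simps)
        also have "cmod \<dots> \<le> e * h + e * h"
          using d1(2)[of h] d2(2)[of h] h by (intro norm_triangle_mono) auto
        finally show ?thesis by (simp add: algebra_simps)
      qed
      then show "\<exists>d>0. \<forall>h. 0 < h \<and> h < d \<longrightarrow>
          cmod (set_lebesgue_integral lborel {x-h..x+h} f - of_real (2 * h) * f x) \<le> e * (2 * h)"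
        using d1(1) d2(1) by (intro exI[of _ "min d1 d2"]) auto
    qed
  qed
qed

text \<open>A nonnegative kernel is the superposition of its superlevel sets, so control of
  \<open>\<psi>\<close> on every superlevel set integrates up to control of \<open>\<psi>\<close> against the kernel.\<close>

lemma layer_cake_bound:
  fixes \<psi> :: "'a \<Rightarrow> complex" and p :: "'a \<Rightarrow> real"
  assumes "finite_measure M" and \<psi>: "integrable M \<psi>"
    and p[measurable]: "p \<in> borel_measurable M"
    and pb: "\<And>x. x \<in> space M \<Longrightarrow> 0 \<le> p x \<and> p x \<le> B"
    and lev: "\<And>u. 0 \<le> u \<Longrightarrow>
      cmod (\<integral>x. indicator {x. u < p x} x *\<^sub>R \<psi> x \<partial>M) \<le> e * (\<integral>x. indicator {x. u < p x} x \<partial>M)"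
  shows "cmod (\<integral>x. p x *\<^sub>R \<psi> x \<partial>M) \<le> e * (\<integral>x. p x \<partial>M)"
proof -
  interpret finite_measure M by fact
  interpret pair_sigma_finite M lborel ..
  have [measurable]: "\<psi> \<in> borel_measurable M" using \<psi> by auto
  let ?k = "\<lambda>x u. indicator {0..<p x} u :: real"
  have k: "(\<lambda>(x, u). ?k x u) \<in> borel_measurable (M \<Otimes>\<^sub>M lborel)"
  proof -
    have "(\<lambda>(x, u). ?k x u) = (\<lambda>z. if 0 \<le> snd z \<and> snd z < p (fst z) then 1 else 0)"
      by (auto simp: indicator_def fun_eq_iff)
    then show ?thesis by simp
  qed
  have fub: "(\<integral>x. p x *\<^sub>R F x \<partial>M) = (\<integral>u. (\<integral>x. ?k x u *\<^sub>R F x \<partial>M) \<partial>lborel)"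
      "integrable lborel (\<lambda>u. \<integral>x. ?k x u *\<^sub>R F x \<partial>M)"
    if F: "integrable M F" for F :: "'a \<Rightarrow> 'c::{banach, second_countable_topology}"
  proof -
    have [measurable]: "F \<in> borel_measurable M" using F by auto
    have int: "integrable (M \<Otimes>\<^sub>M lborel) (\<lambda>(x, u). ?k x u *\<^sub>R F x)"
    proof (rule Fubini_integrable)
      show "(\<lambda>(x, u). ?k x u *\<^sub>R F x) \<in> borel_measurable (M \<Otimes>\<^sub>M lborel)"
        using k by (simp add: split_beta)
      have eq: "(\<integral>u. norm (?k x u *\<^sub>R F x) \<partial>lborel) = p x * norm (F x)" if "x \<in> space M" for x
        using pb[OF that] by simp
      moreover have "integrable M (\<lambda>x. p x * norm (F x))"
      proof (rule Bochner_Integration.integrable_bound[of M "\<lambda>x. B * norm (F x)"])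
        show "AE x in M. norm (p x * norm (F x)) \<le> norm (B * norm (F x))"
        proof (rule AE_I2)
          fix x assume "x \<in> space M"
          then have "0 \<le> p x" "p x \<le> B" using pb by auto
          then show "norm (p x * norm (F x)) \<le> norm (B * norm (F x))"
            by (simp add: abs_mult mult_right_mono)
        qed
      qed (use F in auto)
      ultimately show "integrable M (\<lambda>x. \<integral>u. norm (case (x, u) of (x, u) \<Rightarrow> ?k x u *\<^sub>R F x) \<partial>lborel)"
        unfolding prod.case by (subst Bochner_Integration.integrable_cong[OF refl eq]) auto
      show "AE x in M. integrable lborel (\<lambda>u. case (x, u) of (x, u) \<Rightarrow> ?k x u *\<^sub>R F x)"
        by (rule AE_I2) (use pb in \<open>auto intro!: integrable_scaleR_left integrable_real_indicator\<close>)
    qed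
    have "(\<integral>u. ?k x u *\<^sub>R F x \<partial>lborel) = p x *\<^sub>R F x" if "x \<in> space M" for x
      using pb[OF that] by (subst integral_scaleR_left) (auto intro!: integrable_real_indicator)
    then have "(\<integral>x. p x *\<^sub>R F x \<partial>M) = (\<integral>x. (\<integral>u. ?k x u *\<^sub>R F x \<partial>lborel) \<partial>M)"
      by (intro Bochner_Integration.integral_cong) auto
    also have "\<dots> = (\<integral>u. (\<integral>x. ?k x u *\<^sub>R F x \<partial>M) \<partial>lborel)"
      using Fubini_integral[OF int] by simp
    finally show "(\<integral>x. p x *\<^sub>R F x \<partial>M) = (\<integral>u. (\<integral>x. ?k x u *\<^sub>R F x \<partial>M) \<partial>lborel)" .
    show "integrable lborel (\<lambda>u. \<integral>x. ?k x u *\<^sub>R F x \<partial>M)"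
      using integrable_snd[of "\<lambda>x u. ?k x u *\<^sub>R F x"] int by simp
  qed
  have one: "integrable M (\<lambda>x. 1::real)" by simp
  have "cmod (\<integral>x. p x *\<^sub>R \<psi> x \<partial>M) \<le> (\<integral>u. cmod (\<integral>x. ?k x u *\<^sub>R \<psi> x \<partial>M) \<partial>lborel)"
    unfolding fub(1)[OF \<psi>] by (rule integral_norm_bound)
  also have "\<dots> \<le> (\<integral>u. e * (\<integral>x. ?k x u *\<^sub>R (1::real) \<partial>M) \<partial>lborel)"
  proof (rule integral_mono)
    fix u :: real
    show "cmod (\<integral>x. ?k x u *\<^sub>R \<psi> x \<partial>M) \<le> e * (\<integral>x. ?k x u *\<^sub>R (1::real) \<partial>M)"
    proof (cases "0 \<le> u")
      case True
      then have "?k x u = indicator {x. u < p x} x" for x by (auto simp: indicator_def)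
      then show ?thesis using lev[OF True] by simp
    next
      case False
      then have "?k x u = 0" for x by (auto simp: indicator_def)
      then show ?thesis by simp
    qed
  qed (use fub(2)[OF \<psi>] fub(2)[OF one] in auto)
  also have "\<dots> = e * (\<integral>x. p x *\<^sub>R (1::real) \<partial>M)"
    using fub(1)[OF one] by simp
  finally show ?thesis by simp
qed

section \<open>Radial limits of Poisson integrals\<close>

text \<open>The averages of \<open>f - f z\<close> are taken over arcs centred at \<open>z\<close>, described by the real part
  of \<open>z * cnj w\<close>, because these are the superlevel sets of the Poisson kernel. For \<open>d \<ge> 1\<close> the arc
  is empty and the inequality is trivial.\<close>

definition lebesgue_point :: "(complex \<Rightarrow> complex) \<Rightarrow> complex \<Rightarrow> bool" where
  "lebesgue_point f z \<longleftrightarrow> (\<forall>e>0. \<exists>c<1. \<forall>d\<ge>c.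
     cmod (\<integral>w. indicator {w. d < Re (z * cnj w)} w *\<^sub>R (f w - f z) \<partial>circle_measure)
       \<le> e * (\<integral>w. indicator {w. d < Re (z * cnj w)} w \<partial>circle_measure))"

lemma borel_arc [measurable]: "{w. d < Re (z * cnj w)} \<in> sets borel"
  by (intro borel_open open_Collect_less continuous_intros)

text \<open>As long as the interval of radius \<open>s\<close> about \<open>x\<close> stays inside the parameter interval, the arc
  does not wrap around and corresponds to that interval.\<close>

lemma arc_parameters:
  assumes "0 < s" "s \<le> x" "s \<le> 2 * pi - x" "0 \<le> t" "t < 2 * pi"
  shows "cos s < Re (cis x * cnj (cis t)) \<longleftrightarrow> \<bar>t - x\<bar> < s"
proof -
  have eq: "Re (cis x * cnj (cis t)) = cos \<bar>t - x\<bar>"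
    by (simp add: cos_diff abs_if)
  let ?y = "\<bar>t - x\<bar>"
  have y: "0 \<le> ?y" "?y \<le> 2 * pi - s" and s: "s \<le> pi" using assms by auto
  show ?thesis
  proof (cases "?y \<le> pi")
    case True
    then show ?thesis unfolding eq
      using cos_mono_less_eq[of s ?y] y s assms by auto
  next
    case False
    have "cos (2 * pi - ?y) \<le> cos s"
      by (rule cos_monotone_0_pi_le) (use False y assms in auto)
    moreover have "cos (2 * pi - ?y) = cos ?y" by (simp add: cos_diff)
    ultimately show ?thesis unfolding eq using False s by auto
  qed
qed

lemma AE_lebesgue_point:
  assumes f: "integrable circle_measure f"
  shows "AE z in circle_measure. lebesgue_point f z"
proof (rule AE_circleI)
  have fm: "f \<in> borel_measurable circle_measure" using f by auto
  note fc[measurable] = measurable_comp_cis[OF fm]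
  define \<phi> where "\<phi> = (\<lambda>t. indicator {0..<2 * pi} t *\<^sub>R f (cis t))"
  have \<phi>: "integrable lborel \<phi>"
    using f unfolding integrable_circle_iff[OF fm] set_integrable_def \<phi>_def .
  show "AE x in lborel. x \<in> {0..<2 * pi} \<longrightarrow> lebesgue_point f (cis x)"
    using symmetric_averages_tendsto[OF \<phi>] AE_lborel_singleton[of 0]
  proof eventually_elim
    fix x :: real
    assume avg: "\<forall>e>0. \<exists>d>0. \<forall>h. 0 < h \<and> h < d \<longrightarrow>
        cmod (set_lebesgue_integral lborel {x-h..x+h} \<phi> - of_real (2 * h) * \<phi> x) \<le> e * (2 * h)"
      and "x \<noteq> 0"
    show "x \<in> {0..<2 * pi} \<longrightarrow> lebesgue_point f (cis x)"
    proof
      assume "x \<in> {0..<2 * pi}"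
      then have x: "0 < x" "x < 2 * pi" using \<open>x \<noteq> 0\<close> by auto
      show "lebesgue_point f (cis x)"
        unfolding lebesgue_point_def
      proof (intro allI impI)
        fix e :: real assume "e > 0"
        then obtain d0 where d0: "d0 > 0" "\<And>h. 0 < h \<and> h < d0 \<Longrightarrow>
            cmod (set_lebesgue_integral lborel {x-h..x+h} \<phi> - of_real (2 * h) * \<phi> x) \<le> e * (2 * h)"
          using avg by blast
        \<comment> \<open>Below \<open>d0\<close> the averages are controlled; the other two terms keep the arc from
          wrapping around.\<close>
        define a where "a = min (d0 / 2) (min x (2 * pi - x))"
        have a: "0 < a" "a < d0" "a \<le> x" "a \<le> 2 * pi - x" "a \<le> pi"
          using d0 x by (auto simp: a_def)
        have bound: "cmod (\<integral>w. indicator {w. d < Re (cis x * cnj w)} w *\<^sub>R (f w - f (cis x)) \<partial>circle_measure)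
            \<le> e * (\<integral>w. indicator {w. d < Re (cis x * cnj w)} w \<partial>circle_measure)"
          if d: "cos a \<le> d" for d
        proof (cases "d < 1")
          case False
          have z: "indicator {w. d < Re (cis x * cnj w)} w = (0::real)" if "w \<in> space circle_measure" for w
          proof -
            have "Re (cis x * cnj w) \<le> cmod (cis x * cnj w)" by (rule complex_Re_le_cmod)
            also have "\<dots> = 1" using that by (simp add: norm_mult space_circle)
            finally show ?thesis using False by (auto simp: indicator_def)
          qed
          have "(\<integral>w. indicator {w. d < Re (cis x * cnj w)} w *\<^sub>R (f w - f (cis x)) \<partial>circle_measure) =
              (\<integral>w. 0 \<partial>circle_measure)"
            using z by (intro Bochner_Integration.integral_cong) auto
          moreover have "(\<integral>w. indicator {w. d < Re (cis x * cnj w)} w \<partial>circle_measure) =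
              (\<integral>w. 0 \<partial>circle_measure :: real)"
            using z by (intro Bochner_Integration.integral_cong) auto
          ultimately show ?thesis by simp
        next
          case True
          define s where "s = arccos d"
          have d': "-1 \<le> d" using d cos_ge_minus_one[of a] by linarith
          have cs: "cos s = d" and s0: "0 < s" and sa: "s \<le> a"
          proof -
            show "cos s = d" using True d' by (simp add: s_def)
            show "0 < s" using True d' arccos_less_mono[of 1 d] by (simp add: s_def)
            have "arccos d \<le> arccos (cos a)" using d True by (intro arccos_le_mono[THEN iffD2]) (use d' in auto)
            then show "s \<le> a" using a by (simp add: s_def arccos_cos)
          qed
          have par: "d < Re (cis x * cnj (cis t)) \<longleftrightarrow> \<bar>t - x\<bar> < s" if "0 \<le> t" "t < 2 * pi" for t
            using arc_parameters[of s x t] that s0 sa a by (simp add: cs)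
          have AEb: "AE t in lborel. t \<noteq> x - s \<and> t \<noteq> x + s"
            using AE_lborel_singleton[of "x - s"] AE_lborel_singleton[of "x + s"] by eventually_elim auto
          have m1: "(\<lambda>t. indicator {w. d < Re (cis x * cnj w)} (cis t) :: real) \<in> borel_measurable borel"
            by (rule measurable_comp_cis, rule borel_measurable_circle) measurable
          have m2: "(\<lambda>w. indicator {w. d < Re (cis x * cnj w)} w *\<^sub>R (f w - f (cis x)))
              \<in> borel_measurable circle_measure"
            by (intro borel_measurable_scaleR borel_measurable_diff fm borel_measurable_const
                borel_measurable_circle[OF borel_measurable_indicator] borel_arc)
          have si: "set_integrable lborel {x-s..x+s} \<phi>"
            unfolding set_integrable_def by (rule integrable_mult_indicator) (use \<phi> in auto)
          have "(\<integral>w. indicator {w. d < Re (cis x * cnj w)} w *\<^sub>R (f w - f (cis x)) \<partial>circle_measure) =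
              (1 / (2 * pi)) *\<^sub>R (\<integral>t. indicator {0..<2*pi} t *\<^sub>R
                 (indicator {w. d < Re (cis x * cnj w)} (cis t) *\<^sub>R (f (cis t) - f (cis x))) \<partial>lborel)"
            by (subst integral_circle[OF m2]) (simp add: set_lebesgue_integral_def)
          also have "(\<integral>t. indicator {0..<2*pi} t *\<^sub>R
                 (indicator {w. d < Re (cis x * cnj w)} (cis t) *\<^sub>R (f (cis t) - f (cis x))) \<partial>lborel) =
              (\<integral>t. indicator {x-s..x+s} t *\<^sub>R \<phi> t - indicator {x-s..x+s} t *\<^sub>R \<phi> x \<partial>lborel)"
          proof (rule integral_cong_AE)
            show "(\<lambda>t. indicator {0..<2*pi} t *\<^sub>R
                 (indicator {w. d < Re (cis x * cnj w)} (cis t) *\<^sub>R (f (cis t) - f (cis x))))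
                 \<in> borel_measurable lborel" using m1 fc by simp
            show "(\<lambda>t. indicator {x-s..x+s} t *\<^sub>R \<phi> t - indicator {x-s..x+s} t *\<^sub>R \<phi> x)
                 \<in> borel_measurable lborel" using \<phi> by simp
            show "AE t in lborel. indicator {0..<2*pi} t *\<^sub>R
                 (indicator {w. d < Re (cis x * cnj w)} (cis t) *\<^sub>R (f (cis t) - f (cis x))) =
                 indicator {x-s..x+s} t *\<^sub>R \<phi> t - indicator {x-s..x+s} t *\<^sub>R \<phi> x"
              using AEb AE_lborel_singleton[of "2 * pi"]
            proof eventually_elim
              fix t assume t: "t \<noteq> x - s \<and> t \<noteq> x + s" "t \<noteq> 2 * pi"
              show "indicator {0..<2*pi} t *\<^sub>R
                 (indicator {w. d < Re (cis x * cnj w)} (cis t) *\<^sub>R (f (cis t) - f (cis x))) =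
                 indicator {x-s..x+s} t *\<^sub>R \<phi> t - indicator {x-s..x+s} t *\<^sub>R \<phi> x"
              proof (cases "0 \<le> t \<and> t < 2 * pi")
                case True
                then show ?thesis using par[of t] t x by (auto simp: indicator_def \<phi>_def abs_if)
              next
                case False
                then have "t \<notin> {x-s..x+s}" using sa a t by auto
                then show ?thesis using False by auto
              qed
            qed
          qed
          also have "\<dots> = set_lebesgue_integral lborel {x-s..x+s} \<phi> - of_real (2 * s) * \<phi> x"
          proof -
            have "integrable lborel (\<lambda>t. indicator {x-s..x+s} t *\<^sub>R \<phi> x)"
              by (intro integrable_scaleR_left integrable_real_indicator) (use s0 in auto)
            moreover have "(\<integral>t. indicator {x-s..x+s} t *\<^sub>R \<phi> x \<partial>lborel) = of_real (2 * s) * \<phi> x"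
              using s0 by (subst integral_scaleR_left)
                (auto intro!: integrable_real_indicator simp: scaleR_conv_of_real)
            ultimately show ?thesis
              using si unfolding set_integrable_def set_lebesgue_integral_def
              by (subst Bochner_Integration.integral_diff) auto
          qed
          finally have A: "(\<integral>w. indicator {w. d < Re (cis x * cnj w)} w *\<^sub>R (f w - f (cis x)) \<partial>circle_measure) =
             (1 / (2 * pi)) *\<^sub>R (set_lebesgue_integral lborel {x-s..x+s} \<phi> - of_real (2 * s) * \<phi> x)" .
          have "(\<integral>w. indicator {w. d < Re (cis x * cnj w)} w \<partial>circle_measure) =
              (1 / (2 * pi)) *\<^sub>R (\<integral>t. indicator {0..<2*pi} t *\<^sub>R
                 (indicator {w. d < Re (cis x * cnj w)} (cis t) :: real) \<partial>lborel)"
            by (subst integral_circle)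
              (auto simp: set_lebesgue_integral_def intro!: borel_measurable_circle)
          also have "(\<integral>t. indicator {0..<2*pi} t *\<^sub>R
                 (indicator {w. d < Re (cis x * cnj w)} (cis t) :: real) \<partial>lborel) =
              (\<integral>t. indicator {x-s..x+s} t \<partial>lborel)"
          proof (rule integral_cong_AE)
            show "AE t in lborel. indicator {0..<2*pi} t *\<^sub>R
                 (indicator {w. d < Re (cis x * cnj w)} (cis t) :: real) = indicator {x-s..x+s} t"
              using AEb AE_lborel_singleton[of "2 * pi"]
            proof eventually_elim
              fix t assume t: "t \<noteq> x - s \<and> t \<noteq> x + s" "t \<noteq> 2 * pi"
              show "indicator {0..<2*pi} t *\<^sub>R
                 (indicator {w. d < Re (cis x * cnj w)} (cis t) :: real) = indicator {x-s..x+s} t"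
              proof (cases "0 \<le> t \<and> t < 2 * pi")
                case True
                then show ?thesis using par[of t] t x by (auto simp: indicator_def abs_if)
              next
                case False
                then have "t \<notin> {x-s..x+s}" using sa a t by auto
                then show ?thesis using False by auto
              qed
            qed
          qed (use m1 in simp_all)
          also have "\<dots> = 2 * s" using s0 by simp
          finally have B: "(\<integral>w. indicator {w. d < Re (cis x * cnj w)} w \<partial>circle_measure) = s / pi"
            by simp
          define D where "D = set_lebesgue_integral lborel {x-s..x+s} \<phi> - of_real (2 * s) * \<phi> x"
          have "cmod D \<le> e * (2 * s)"
            unfolding D_def using d0(2)[of s] s0 sa a by auto
          then show ?thesis
            unfolding A B D_def[symmetric] by (simp add: field_simps)
        qed
        have "cos a < 1" using a cos_monotone_0_pi[of 0 a] by simp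
        with bound show "\<exists>c<1. \<forall>d\<ge>c.
            cmod (\<integral>w. indicator {w. d < Re (cis x * cnj w)} w *\<^sub>R (f w - f (cis x)) \<partial>circle_measure)
            \<le> e * (\<integral>w. indicator {w. d < Re (cis x * cnj w)} w \<partial>circle_measure)"
          by blast
      qed
    qed
  qed
qed

text \<open>For \<open>u\<close> on the circle this is the Poisson kernel, since the denominator is then the square
  of the modulus of \<open>1 - r * u\<close>.\<close>

definition poisson_kernel :: "real \<Rightarrow> complex \<Rightarrow> real" where
  "poisson_kernel r u = (1 - r\<^sup>2) / (1 - 2 * r * Re u + r\<^sup>2)"

definition fourier :: "(complex \<Rightarrow> complex) \<Rightarrow> int \<Rightarrow> complex" where
  "fourier f n = (\<integral>w. f w * w powi (- n) \<partial>circle_measure)"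

definition poisson :: "(complex \<Rightarrow> complex) \<Rightarrow> real \<Rightarrow> complex \<Rightarrow> complex" where
  "poisson f r z = (\<integral>w. poisson_kernel r (z * cnj w) *\<^sub>R f w \<partial>circle_measure)"

lemma poisson_denom_pos:
  assumes "0 \<le> r" "r < 1" "cmod u = 1"
  shows "0 < 1 - 2 * r * Re u + r\<^sup>2"
proof -
  have "r * Re u \<le> r * 1" using assms complex_Re_le_cmod[of u] by (intro mult_left_mono) auto
  moreover have "0 < (1 - r)\<^sup>2" using assms by simp
  ultimately show ?thesis by (simp add: power2_diff)
qed

lemma poisson_kernel_nonneg:
  assumes "0 \<le> r" "r < 1" "cmod u = 1"
  shows "0 \<le> poisson_kernel r u"
  unfolding poisson_kernel_def using poisson_denom_pos[OF assms] assms
  by (intro divide_nonneg_pos) (auto simp: power_le_one)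

text \<open>At the edge of the arc the denominator is \<open>(1 - c\<^sup>2) + (c - r)\<^sup>2\<close>, which is bounded below
  uniformly in \<open>r\<close>.\<close>

lemma poisson_kernel_off_arc:
  assumes "0 \<le> r" "r < 1" "cmod u = 1" "Re u \<le> c" "0 \<le> c" "c < 1"
  shows "poisson_kernel r u \<le> (1 - r\<^sup>2) / (1 - c\<^sup>2)"
proof -
  have "1 - c\<^sup>2 \<le> 1 - c\<^sup>2 + (c - r)\<^sup>2" by simp
  also have "\<dots> = 1 - 2 * r * c + r\<^sup>2" by (simp add: power2_diff)
  also have "\<dots> \<le> 1 - 2 * r * Re u + r\<^sup>2" using assms by (simp add: mult_left_mono)
  finally show ?thesis
    unfolding poisson_kernel_def using assms
    by (intro divide_left_mono mult_pos_pos poisson_denom_pos) (auto simp: power_le_one power_less_one_iff abs_square_less_1)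
qed

lemma poisson_kernel_le:
  assumes "0 \<le> r" "r < 1" "cmod u = 1"
  shows "poisson_kernel r u \<le> (1 - r\<^sup>2) / (1 - r)\<^sup>2"
proof -
  have "r * Re u \<le> r * 1" using assms complex_Re_le_cmod[of u] by (intro mult_left_mono) auto
  then have "(1 - r)\<^sup>2 \<le> 1 - 2 * r * Re u + r\<^sup>2" by (simp add: power2_diff)
  then show ?thesis
    unfolding poisson_kernel_def using assms
    by (intro divide_left_mono mult_pos_pos poisson_denom_pos) (auto simp: power_le_one)
qed

lemma poisson_kernel_geometric:
  assumes "0 \<le> r" "r < 1" "cmod u = 1"
  shows "complex_of_real (poisson_kernel r u) =
    1 / (1 - of_real r * u) + 1 / (1 - of_real r * cnj u) - 1"
proof -
  have uu: "u * cnj u = 1" using assms by (simp add: complex_norm_square[symmetric])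
  have ne: "1 - of_real r * u \<noteq> 0" "1 - of_real r * cnj u \<noteq> 0"
  proof -
    have "cmod (of_real r * u) < 1" "cmod (of_real r * cnj u) < 1"
      using assms by (auto simp: norm_mult)
    then show "1 - of_real r * u \<noteq> 0" "1 - of_real r * cnj u \<noteq> 0" by auto
  qed
  have den: "(1 - of_real r * u) * (1 - of_real r * cnj u) =
      complex_of_real (1 - 2 * r * Re u + r\<^sup>2)"
  proof -
    have "(1 - of_real r * u) * (1 - of_real r * cnj u) =
        1 - of_real r * (u + cnj u) + of_real (r\<^sup>2) * (u * cnj u)"
      by (simp add: algebra_simps power2_eq_square)
    then show ?thesis unfolding uu complex_add_cnj by simp
  qed
  have sum_of_inverses: "1 / A + 1 / B - 1 = (B + A - A * B) / (A * B)"
    if "A \<noteq> 0" "B \<noteq> 0" for A B :: complex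
    using that by (simp add: field_simps)
  have "1 / (1 - of_real r * u) + 1 / (1 - of_real r * cnj u) - 1 =
     ((1 - of_real r * cnj u) + (1 - of_real r * u) - (1 - of_real r * u) * (1 - of_real r * cnj u)) /
     ((1 - of_real r * u) * (1 - of_real r * cnj u))"
    using ne by (intro sum_of_inverses)
  also have "(1 - of_real r * cnj u) + (1 - of_real r * u) - (1 - of_real r * u) * (1 - of_real r * cnj u)
     = 1 - of_real (r\<^sup>2) * (u * cnj u)"
    by (simp add: algebra_simps power2_eq_square)
  finally show ?thesis
    unfolding den uu poisson_kernel_def by simp
qed

lemma measurable_poisson_kernel:
  "(\<lambda>w. poisson_kernel r (z * cnj w)) \<in> borel_measurable circle_measure"
  unfolding poisson_kernel_def by (rule borel_measurable_circle) measurable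

lemma cnj_eq_inverse: "cmod w = 1 \<Longrightarrow> cnj w = inverse w"
  by (metis complex_norm_square inverse_unique mult_1 of_real_1 power_one)

lemma cnj_power_eq_powi: "cmod w = 1 \<Longrightarrow> cnj w ^ n = w powi (- int n)"
  by (simp only: cnj_eq_inverse power_int_minus power_int_of_nat power_inverse)

lemma integral_geometric_kernel:
  fixes f b :: "complex \<Rightarrow> complex"
  assumes f: "integrable circle_measure f" and b: "b \<in> borel_measurable circle_measure"
    and bq: "\<And>w. cmod w = 1 \<Longrightarrow> cmod (b w) \<le> q" and q: "q < 1"
  shows "integrable circle_measure (\<lambda>w. f w / (1 - b w))"
    and "(\<lambda>n. \<integral>w. f w * b w ^ n \<partial>circle_measure) sums (\<integral>w. f w / (1 - b w) \<partial>circle_measure)"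
proof -
  have fm[measurable]: "f \<in> borel_measurable circle_measure" using f by auto
  note b[measurable]
  have q0: "0 \<le> q" using bq[of 1] norm_ge_zero[of "b 1"] by (simp del: norm_ge_zero)
  have int: "integrable circle_measure (\<lambda>w. f w * b w ^ n)" for n
  proof (rule Bochner_Integration.integrable_bound[OF f])
    show "AE w in circle_measure. norm (f w * b w ^ n) \<le> norm (f w)"
    proof (rule AE_I2)
      fix w assume "w \<in> space circle_measure"
      then have "cmod (b w) ^ n \<le> 1"
        using bq[of w] q by (intro power_le_one) (auto simp: space_circle)
      then show "norm (f w * b w ^ n) \<le> norm (f w)"
        by (simp add: norm_mult norm_power mult_left_le)
    qed
  qed measurable
  have geo: "(\<lambda>n. f w * b w ^ n) sums (f w / (1 - b w))" if "w \<in> space circle_measure" for w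
  proof -
    have "cmod (b w) < 1" using bq[of w] q that by (simp add: space_circle)
    from sums_mult[OF geometric_sums[OF this], of "f w"] show ?thesis by simp
  qed
  have AEs: "AE w in circle_measure. summable (\<lambda>n. norm (f w * b w ^ n))"
  proof (rule AE_I2)
    fix w assume "w \<in> space circle_measure"
    then have "cmod (b w) < 1" using bq[of w] q by (simp add: space_circle)
    then show "summable (\<lambda>n. norm (f w * b w ^ n))"
      by (simp add: norm_mult norm_power summable_mult summable_geometric)
  qed
  have sum: "summable (\<lambda>n. \<integral>w. norm (f w * b w ^ n) \<partial>circle_measure)"
  proof (rule summable_comparison_test)
    show "\<exists>N. \<forall>n\<ge>N. norm (\<integral>w. norm (f w * b w ^ n) \<partial>circle_measure)
        \<le> q ^ n * (\<integral>w. norm (f w) \<partial>circle_measure)"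
    proof (intro exI allI impI)
      fix n :: nat
      have "(\<integral>w. norm (f w * b w ^ n) \<partial>circle_measure) \<le> (\<integral>w. q ^ n * norm (f w) \<partial>circle_measure)"
      proof (rule integral_mono)
        fix w assume "w \<in> space circle_measure"
        then have "cmod (b w) ^ n \<le> q ^ n"
          using bq[of w] by (intro power_mono) (auto simp: space_circle)
        then show "norm (f w * b w ^ n) \<le> q ^ n * norm (f w)"
          using mult_right_mono[of "cmod (b w) ^ n" "q ^ n" "cmod (f w)"]
          by (simp add: norm_mult norm_power mult.commute)
      qed (use int f in auto)
      then show "norm (\<integral>w. norm (f w * b w ^ n) \<partial>circle_measure)
        \<le> q ^ n * (\<integral>w. norm (f w) \<partial>circle_measure)" by simp
    qed
    show "summable (\<lambda>n. q ^ n * (\<integral>w. norm (f w) \<partial>circle_measure))"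
      using q q0 by (intro summable_mult2 summable_geometric) auto
  qed
  have eq: "(\<Sum>n. f w * b w ^ n) = f w / (1 - b w)" if "w \<in> space circle_measure" for w
    using geo[OF that] by (simp add: sums_iff)
  show "integrable circle_measure (\<lambda>w. f w / (1 - b w))"
    using integrable_suminf[OF int AEs sum] by (simp add: eq cong: Bochner_Integration.integrable_cong)
  show "(\<lambda>n. \<integral>w. f w * b w ^ n \<partial>circle_measure) sums (\<integral>w. f w / (1 - b w) \<partial>circle_measure)"
    using sums_integral[OF int AEs sum] by (simp add: eq cong: Bochner_Integration.integral_cong)
qed

text \<open>Expanding the kernel into two geometric series turns a Poisson integral into the Abel
  means of the Fourier series.\<close>

lemma poisson_series:
  assumes f: "integrable circle_measure f" and r: "0 \<le> r" "r < 1" and z: "cmod z = 1"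
  shows "(\<lambda>n. (of_real r * z) ^ n * fourier f (int n)) sums
           (\<integral>w. f w / (1 - of_real r * z * cnj w) \<partial>circle_measure)" (is "?S1")
    and "(\<lambda>n. (of_real r * cnj z) ^ n * fourier f (- int n)) sums
           (\<integral>w. f w / (1 - of_real r * cnj z * w) \<partial>circle_measure)" (is "?S2")
    and "poisson f r z = (\<integral>w. f w / (1 - of_real r * z * cnj w) \<partial>circle_measure) +
           (\<integral>w. f w / (1 - of_real r * cnj z * w) \<partial>circle_measure) - fourier f 0" (is "?P")
proof -
  let ?b1 = "\<lambda>w. of_real r * z * cnj w" and ?b2 = "\<lambda>w. of_real r * cnj z * w"
  have b1: "?b1 \<in> borel_measurable circle_measure" "\<And>w. cmod w = 1 \<Longrightarrow> cmod (?b1 w) \<le> r"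
    by (rule borel_measurable_circle, measurable) (use r z in \<open>auto simp: norm_mult\<close>)
  have b2: "?b2 \<in> borel_measurable circle_measure" "\<And>w. cmod w = 1 \<Longrightarrow> cmod (?b2 w) \<le> r"
    by (rule borel_measurable_circle, measurable) (use r z in \<open>auto simp: norm_mult\<close>)
  note G1 = integral_geometric_kernel[OF f b1 r(2)]
  note G2 = integral_geometric_kernel[OF f b2 r(2)]
  have c1: "(\<integral>w. f w * ?b1 w ^ n \<partial>circle_measure) = (of_real r * z) ^ n * fourier f (int n)" for n
  proof -
    have "(\<integral>w. f w * ?b1 w ^ n \<partial>circle_measure) =
        (\<integral>w. (of_real r * z) ^ n * (f w * w powi (- int n)) \<partial>circle_measure)"
    proof (rule Bochner_Integration.integral_cong)
      fix w assume "w \<in> space circle_measure"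
      then have "w powi (- int n) = cnj w ^ n" by (simp add: space_circle cnj_power_eq_powi)
      then show "f w * ?b1 w ^ n = (of_real r * z) ^ n * (f w * w powi (- int n))"
        by (simp add: power_mult_distrib mult_ac)
    qed simp
    then show ?thesis by (simp add: fourier_def)
  qed
  have c2: "(\<integral>w. f w * ?b2 w ^ n \<partial>circle_measure) = (of_real r * cnj z) ^ n * fourier f (- int n)" for n
    by (simp add: fourier_def power_mult_distrib mult_ac flip: integral_mult_right_zero)
  show ?S1 using G1(2) unfolding c1 by simp
  show ?S2 using G2(2) unfolding c2 by simp
  have "poisson f r z = (\<integral>w. f w / (1 - ?b1 w) + f w / (1 - ?b2 w) - f w \<partial>circle_measure)"
    unfolding poisson_def
  proof (rule Bochner_Integration.integral_cong)
    fix w assume "w \<in> space circle_measure"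
    then have "cmod (z * cnj w) = 1" using z by (simp add: space_circle norm_mult)
    from poisson_kernel_geometric[OF r this]
    have k: "of_real (poisson_kernel r (z * cnj w)) = 1 / (1 - ?b1 w) + 1 / (1 - ?b2 w) - 1"
      by (simp add: mult_ac)
    show "poisson_kernel r (z * cnj w) *\<^sub>R f w = f w / (1 - ?b1 w) + f w / (1 - ?b2 w) - f w"
      unfolding scaleR_conv_of_real k by (simp add: ring_distribs)
  qed simp
  also have "\<dots> = (\<integral>w. f w / (1 - ?b1 w) \<partial>circle_measure) + (\<integral>w. f w / (1 - ?b2 w) \<partial>circle_measure)
      - fourier f 0"
    using G1(1) G2(1) f by (simp add: fourier_def)
  finally show ?P .
qed

lemma fourier_one: "fourier (\<lambda>_. 1) n = (if n = 0 then 1 else 0)"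
  using integral_circle_powi[of "- n"] by (simp add: fourier_def)

lemma poisson_one:
  assumes "0 \<le> r" "r < 1" "cmod z = 1"
  shows "poisson (\<lambda>_. 1) r z = 1"
proof -
  have one: "integrable circle_measure (\<lambda>_. 1 :: complex)" by simp
  have "(\<lambda>n. (of_real r * z) ^ n * fourier (\<lambda>_. 1) (int n)) sums 1"
    using sums_single[of 0 "\<lambda>_. 1 :: complex"] by (rule sums_cong[THEN iffD1, rotated]) (auto simp: fourier_one)
  moreover have "(\<lambda>n. (of_real r * cnj z) ^ n * fourier (\<lambda>_. 1) (- int n)) sums 1"
    using sums_single[of 0 "\<lambda>_. 1 :: complex"] by (rule sums_cong[THEN iffD1, rotated]) (auto simp: fourier_one)
  ultimately show ?thesis
    using poisson_series[OF one assms] by (simp add: sums_iff fourier_one)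
qed

lemma integrable_poisson:
  assumes f: "integrable circle_measure f" and r: "0 \<le> r" "r < 1" and z: "cmod z = 1"
  shows "integrable circle_measure (\<lambda>w. poisson_kernel r (z * cnj w) *\<^sub>R (f w :: 'b::{banach,second_countable_topology}))"
proof (rule Bochner_Integration.integrable_bound[of _ "\<lambda>w. ((1 - r\<^sup>2) / (1 - r)\<^sup>2) *\<^sub>R f w"])
  show "(\<lambda>w. poisson_kernel r (z * cnj w) *\<^sub>R f w) \<in> borel_measurable circle_measure"
    using f measurable_poisson_kernel by (intro borel_measurable_scaleR) auto
  show "AE w in circle_measure. norm (poisson_kernel r (z * cnj w) *\<^sub>R f w)
      \<le> norm (((1 - r\<^sup>2) / (1 - r)\<^sup>2) *\<^sub>R f w)"
  proof (rule AE_I2)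
    fix w assume "w \<in> space circle_measure"
    then have "cmod (z * cnj w) = 1" using z by (simp add: space_circle norm_mult)
    from poisson_kernel_nonneg[OF r this] poisson_kernel_le[OF r this]
    have "\<bar>poisson_kernel r (z * cnj w)\<bar> \<le> \<bar>(1 - r\<^sup>2) / (1 - r)\<^sup>2\<bar>" by linarith
    then show "norm (poisson_kernel r (z * cnj w) *\<^sub>R f w) \<le> norm (((1 - r\<^sup>2) / (1 - r)\<^sup>2) *\<^sub>R f w)"
      unfolding norm_scaleR by (rule mult_right_mono) simp
  qed
qed (use f in auto)

text \<open>The part of the kernel near \<open>z\<close> is handled by the layer-cake estimate, because its
  superlevel sets are arcs centred at \<open>z\<close>; off a fixed arc the kernel tends to \<open>0\<close> uniformly.\<close>

lemma poisson_tendsto_at_lebesgue_point: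
  assumes f: "integrable circle_measure f" and z: "cmod z = 1" and L: "lebesgue_point f z"
  shows "((\<lambda>r. poisson f r z) \<longlongrightarrow> f z) (at_left 1)"
proof (rule tendstoI)
  fix e0 :: real assume e0: "e0 > 0"
  define e where "e = e0 / 2"
  have e: "e > 0" using e0 by (simp add: e_def)
  define g where "g = (\<lambda>w. f w - f z)"
  have g: "integrable circle_measure g" unfolding g_def using f by simp
  have gm[measurable]: "g \<in> borel_measurable circle_measure" using g by auto
  obtain c0 where c0: "c0 < 1" "\<And>d. c0 \<le> d \<Longrightarrow>
     cmod (\<integral>w. indicator {w. d < Re (z * cnj w)} w *\<^sub>R g w \<partial>circle_measure)
       \<le> e * (\<integral>w. indicator {w. d < Re (z * cnj w)} w \<partial>circle_measure)"
    using L e unfolding lebesgue_point_def g_def by blast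
  \<comment> \<open>The bound off the arc needs a nonnegative threshold.\<close>
  define c where "c = max c0 0"
  have c: "0 \<le> c" "c < 1" using c0(1) by (auto simp: c_def)
  have arc: "cmod (\<integral>w. indicator {w. d < Re (z * cnj w)} w *\<^sub>R g w \<partial>circle_measure)
       \<le> e * (\<integral>w. indicator {w. d < Re (z * cnj w)} w \<partial>circle_measure)" if "c \<le> d" for d
    using c0(2) that by (simp add: c_def)
  define G where "G = (\<integral>w. cmod (g w) \<partial>circle_measure)"
  have bound: "cmod (poisson f r z - f z) \<le> e + (1 - r\<^sup>2) / (1 - c\<^sup>2) * G" if r: "0 < r" "r < 1" for r
  proof -
    have r': "0 \<le> r" "r < 1" using r by auto
    let ?p = "\<lambda>w. poisson_kernel r (z * cnj w)"
    let ?A = "{w. c < Re (z * cnj w)}"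
    note pm[measurable] = measurable_poisson_kernel[of r z]
    have Am[measurable]: "(\<lambda>w. indicator ?A w :: real) \<in> borel_measurable circle_measure"
      by (rule borel_measurable_circle) measurable
    have u: "cmod (z * cnj w) = 1" if "w \<in> space circle_measure" for w
      using z that by (simp add: space_circle norm_mult)
    have pos: "0 \<le> ?p w" if "w \<in> space circle_measure" for w
      by (rule poisson_kernel_nonneg[OF r' u[OF that]])
    define p where "p = (\<lambda>w. indicator ?A w * ?p w)"
    have pm'[measurable]: "p \<in> borel_measurable circle_measure" unfolding p_def by measurable
    have ig: "integrable circle_measure (\<lambda>w. ?p w *\<^sub>R g w)"
      by (rule integrable_poisson[OF g r' z])
    have i1: "integrable circle_measure ?p"
      using integrable_poisson[of "\<lambda>_. 1 :: real", OF _ r' z] by simp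
    have ip: "integrable circle_measure p"
      by (rule Bochner_Integration.integrable_bound[OF i1 pm'])
        (auto simp: p_def indicator_def)
    have ipg: "integrable circle_measure (\<lambda>w. p w *\<^sub>R g w)"
      by (rule Bochner_Integration.integrable_bound[OF ig borel_measurable_scaleR[OF pm' gm]])
        (auto simp: p_def indicator_def)
    have p1: "(\<integral>w. ?p w \<partial>circle_measure) = 1"
    proof -
      have "complex_of_real (\<integral>w. ?p w \<partial>circle_measure) = poisson (\<lambda>_. 1) r z"
        unfolding poisson_def by (simp add: scaleR_conv_of_real)
      then show ?thesis using poisson_one[OF r' z] by simp
    qed
    have "f z = poisson (\<lambda>_. f z) r z"
      using poisson_one[OF r' z] unfolding poisson_def
      by (simp add: scaleR_conv_of_real)
    then have "poisson f r z - f z = (\<integral>w. ?p w *\<^sub>R g w \<partial>circle_measure)"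
      using integrable_poisson[OF f r' z] integrable_poisson[of "\<lambda>_. f z", OF _ r' z]
      unfolding poisson_def g_def
      by (simp add: scaleR_diff_right del: integral_scaleR_left)
    also have "\<dots> = (\<integral>w. p w *\<^sub>R g w + (?p w - p w) *\<^sub>R g w \<partial>circle_measure)"
      by (simp add: algebra_simps)
    also have "\<dots> = (\<integral>w. p w *\<^sub>R g w \<partial>circle_measure) + (\<integral>w. (?p w - p w) *\<^sub>R g w \<partial>circle_measure)"
      using ipg ig by (intro Bochner_Integration.integral_add) (auto simp: scaleR_diff_left)
    finally have split: "poisson f r z - f z =
      (\<integral>w. p w *\<^sub>R g w \<partial>circle_measure) + (\<integral>w. (?p w - p w) *\<^sub>R g w \<partial>circle_measure)" .
    have near: "cmod (\<integral>w. p w *\<^sub>R g w \<partial>circle_measure) \<le> e * (\<integral>w. p w \<partial>circle_measure)"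
    proof (rule layer_cake_bound[OF circle.finite_measure_axioms g pm'])
      fix w assume w: "w \<in> space circle_measure"
      show "0 \<le> p w \<and> p w \<le> (1 - r\<^sup>2) / (1 - r)\<^sup>2"
        using pos[OF w] poisson_kernel_le[OF r' u[OF w]] by (auto simp: p_def indicator_def)
    next
      fix v :: real assume v: "0 \<le> v"
      \<comment> \<open>Solving \<open>v < poisson_kernel r u\<close> for the real part of \<open>u\<close>.\<close>
      define d where "d = (if v = 0 then c else max c ((1 + r\<^sup>2 - (1 - r\<^sup>2) / v) / (2 * r)))"
      have lev: "v < p w \<longleftrightarrow> d < Re (z * cnj w)" if w: "w \<in> space circle_measure" for w
      proof -
        let ?x = "Re (z * cnj w)"
        have den: "0 < 1 - 2 * r * ?x + r\<^sup>2" by (rule poisson_denom_pos[OF r' u[OF w]])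
        have r2: "0 < 1 - r\<^sup>2" using r by (simp add: power_less_one_iff abs_square_less_1)
        have "v < ?p w \<longleftrightarrow> v = 0 \<or> (1 + r\<^sup>2 - (1 - r\<^sup>2) / v) / (2 * r) < ?x"
        proof (cases "v = 0")
          case True
          then show ?thesis using den r2 by (simp add: poisson_kernel_def)
        next
          case False
          then have v: "v > 0" using v by simp
          have "v < ?p w \<longleftrightarrow> v * (1 - 2 * r * ?x + r\<^sup>2) < 1 - r\<^sup>2"
            unfolding poisson_kernel_def using den by (simp only: pos_less_divide_eq)
          also have "\<dots> \<longleftrightarrow> 1 - 2 * r * ?x + r\<^sup>2 < (1 - r\<^sup>2) / v"
            using v by (simp add: pos_less_divide_eq mult.commute)
          also have "\<dots> \<longleftrightarrow> (1 + r\<^sup>2 - (1 - r\<^sup>2) / v) < ?x * (2 * r)"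
            unfolding mult.commute[of ?x "2 * r"] by linarith
          also have "\<dots> \<longleftrightarrow> (1 + r\<^sup>2 - (1 - r\<^sup>2) / v) / (2 * r) < ?x"
            using r by (subst pos_divide_less_eq) auto
          finally show ?thesis using False by simp
        qed
        then show ?thesis using v by (auto simp: p_def d_def indicator_def)
      qed
      have "c \<le> d" by (simp add: d_def)
      have ind: "indicator {w. v < p w} w = (indicator {w. d < Re (z * cnj w)} w :: real)"
        if "w \<in> space circle_measure" for w
        using lev[OF that] by (simp add: indicator_def)
      have "(\<integral>w. indicator {w. v < p w} w *\<^sub>R g w \<partial>circle_measure) =
            (\<integral>w. indicator {w. d < Re (z * cnj w)} w *\<^sub>R g w \<partial>circle_measure)"
          "(\<integral>w. indicator {w. v < p w} w \<partial>circle_measure) =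
            (\<integral>w. indicator {w. d < Re (z * cnj w)} w \<partial>circle_measure :: real)"
        by (intro Bochner_Integration.integral_cong refl; simp only: ind)+
      then show "cmod (\<integral>w. indicator {w. v < p w} w *\<^sub>R g w \<partial>circle_measure)
          \<le> e * (\<integral>w. indicator {w. v < p w} w \<partial>circle_measure)"
        using arc[OF \<open>c \<le> d\<close>] by simp
    qed
    have "(\<integral>w. p w \<partial>circle_measure) \<le> (\<integral>w. ?p w \<partial>circle_measure)"
      by (rule integral_mono[OF ip i1]) (use pos in \<open>auto simp: p_def indicator_def\<close>)
    then have near': "cmod (\<integral>w. p w *\<^sub>R g w \<partial>circle_measure) \<le> e"
      using near e p1 by (smt (verit) mult_left_le)
    have "cmod (\<integral>w. (?p w - p w) *\<^sub>R g w \<partial>circle_measure)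
        \<le> (\<integral>w. cmod ((?p w - p w) *\<^sub>R g w) \<partial>circle_measure)"
      by (rule integral_norm_bound)
    also have "\<dots> \<le> (\<integral>w. (1 - r\<^sup>2) / (1 - c\<^sup>2) * cmod (g w) \<partial>circle_measure)"
    proof (rule integral_mono)
      show "integrable circle_measure (\<lambda>w. cmod ((?p w - p w) *\<^sub>R g w))"
        using ipg ig by (intro integrable_norm) (auto simp: scaleR_diff_left)
      fix w assume w: "w \<in> space circle_measure"
      have "\<bar>?p w - p w\<bar> \<le> (1 - r\<^sup>2) / (1 - c\<^sup>2)"
      proof (cases "w \<in> ?A")
        case True
        have "0 \<le> 1 - r\<^sup>2" "0 \<le> 1 - c\<^sup>2" using r c by (auto simp: power_le_one)
        then show ?thesis using True by (simp add: p_def)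
      next
        case False
        then show ?thesis
          using poisson_kernel_off_arc[OF r' u[OF w] _ c] pos[OF w] by (simp add: p_def)
      qed
      then show "cmod ((?p w - p w) *\<^sub>R g w) \<le> (1 - r\<^sup>2) / (1 - c\<^sup>2) * cmod (g w)"
        unfolding norm_scaleR by (rule mult_right_mono) simp
    qed (use g in simp)
    also have "\<dots> = (1 - r\<^sup>2) / (1 - c\<^sup>2) * G" by (simp add: G_def)
    finally show ?thesis
      unfolding split using near' by (intro norm_triangle_le) simp
  qed
  have "((\<lambda>r. (1 - r\<^sup>2) / (1 - c\<^sup>2) * G) \<longlongrightarrow> (1 - 1\<^sup>2) / (1 - c\<^sup>2) * G) (at_left 1)"
    by (intro tendsto_intros) (use c in \<open>auto simp: power2_eq_1_iff\<close>)
  then have "((\<lambda>r. (1 - r\<^sup>2) / (1 - c\<^sup>2) * G) \<longlongrightarrow> 0) (at_left 1)" by simp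
  then have "\<forall>\<^sub>F r in at_left 1. (1 - r\<^sup>2) / (1 - c\<^sup>2) * G < e"
    using e by (rule order_tendstoD)
  moreover have "\<forall>\<^sub>F r in at_left (1::real). 0 < r \<and> r < 1"
    by (rule eventually_at_leftI[of 0]) auto
  ultimately show "\<forall>\<^sub>F r in at_left 1. dist (poisson f r z) (f z) < e0"
  proof eventually_elim
    case (elim r)
    then have "cmod (poisson f r z - f z) \<le> e + (1 - r\<^sup>2) / (1 - c\<^sup>2) * G"
      by (intro bound) auto
    with elim(1) have "cmod (poisson f r z - f z) < e + e" by linarith
    then show ?case by (simp add: dist_norm e_def)
  qed
qed

text \<open>Fatou's theorem for Poisson integrals.\<close>

theorem poisson_tendsto_AE:
  assumes "integrable circle_measure f"
  shows "AE z in circle_measure. ((\<lambda>r. poisson f r z) \<longlongrightarrow> f z) (at_left 1)"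
  using AE_lebesgue_point[OF assms] AE_circle_norm
  by eventually_elim (rule poisson_tendsto_at_lebesgue_point[OF assms])

text \<open>The Poisson integral depends only on the Fourier coefficients and recovers the function.\<close>

lemma fourier_unique:
  assumes f: "integrable circle_measure f" and "\<And>n. fourier f n = 0"
  shows "AE z in circle_measure. f z = 0"
  using poisson_tendsto_AE[OF f] AE_circle_norm
proof eventually_elim
  case (elim z)
  have "poisson f r z = 0" if "0 \<le> r" "r < 1" for r
    using poisson_series[OF f that elim(2)] assms(2) by (simp add: sums_iff)
  then have "\<forall>\<^sub>F r in at_left 1. poisson f r z = 0"
    by (intro eventually_at_leftI[of 0]) auto
  then have "((\<lambda>r. poisson f r z) \<longlongrightarrow> 0) (at_left 1)"
    by (rule tendsto_eventually)
  with elim(1) show "f z = 0" by (rule tendsto_unique[rotated]) simp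
qed

section \<open>Boundary values of Hardy functions\<close>

lemma integrable_circle_bounded:
  fixes f :: "complex \<Rightarrow> 'b::{banach,second_countable_topology}"
  assumes "f \<in> borel_measurable circle_measure" and "\<And>w. cmod w = 1 \<Longrightarrow> norm (f w) \<le> B"
  shows "integrable circle_measure f"
  by (rule circle.integrable_const_bound[of _ B]) (use assms in \<open>auto simp: space_circle intro!: AE_I2\<close>)

lemma square_integrable_bounded:
  assumes m: "f \<in> borel_measurable circle_measure" and b: "\<And>w. cmod w = 1 \<Longrightarrow> cmod (f w) \<le> B"
  shows "square_integrable f"
  unfolding square_integrable_def
proof
  note m[measurable]
  show "integrable circle_measure (\<lambda>z. (cmod (f z))\<^sup>2)"
    by (rule integrable_circle_bounded[where B = "B\<^sup>2"]) (use b in \<open>auto intro: power_mono\<close>)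
qed (rule m)

lemma square_integrable_measurable:
  "square_integrable f \<Longrightarrow> f \<in> borel_measurable circle_measure"
  by (simp add: square_integrable_def)

lemma square_integrable_mult:
  assumes "square_integrable f" "square_integrable g"
  shows "integrable circle_measure (\<lambda>z. f z * g z)"
proof (rule Bochner_Integration.integrable_bound)
  show "integrable circle_measure (\<lambda>z. (cmod (f z))\<^sup>2 + (cmod (g z))\<^sup>2)"
    using assms by (simp add: square_integrable_def)
  show "AE z in circle_measure. norm (f z * g z) \<le> norm ((cmod (f z))\<^sup>2 + (cmod (g z))\<^sup>2)"
  proof (rule AE_I2)
    fix z
    have "2 * (cmod (f z) * cmod (g z)) \<le> (cmod (f z))\<^sup>2 + (cmod (g z))\<^sup>2"
      using sum_squares_bound[of "cmod (f z)" "cmod (g z)"] by simp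
    moreover have "0 \<le> cmod (f z) * cmod (g z)" by simp
    ultimately show "norm (f z * g z) \<le> norm ((cmod (f z))\<^sup>2 + (cmod (g z))\<^sup>2)"
      unfolding norm_mult real_norm_def by linarith
  qed
qed (use assms in \<open>auto dest!: square_integrable_measurable\<close>)

lemma square_integrable_cnj:
  "square_integrable f \<Longrightarrow> square_integrable (\<lambda>z. cnj (f z))"
  by (auto simp: square_integrable_def intro!: measurable_cnj)

lemma square_integrable_powi: "square_integrable (\<lambda>z. z powi n)"
  by (rule square_integrable_bounded[where B = 1])
     (auto intro!: borel_measurable_circle simp: norm_power_int)

lemma square_integrable_imp_integrable:
  assumes "square_integrable f" shows "integrable circle_measure f"
  using square_integrable_mult[OF assms square_integrable_powi[of 0]] by simp

text \<open>Bounded in mean square and pointwise null implies weakly null: where the size of \<open>h k\<close>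
  is at most \<open>R\<close> times that of \<open>u\<close>, dominated convergence applies, and elsewhere the product is
  at most \<open>1 / R\<close> times the square of \<open>h k\<close>.\<close>

lemma weakly_null:
  fixes h :: "nat \<Rightarrow> complex \<Rightarrow> complex"
  assumes u: "square_integrable u" and h: "\<And>k. square_integrable (h k)"
    and M: "\<And>k. (\<integral>z. (cmod (h k z))\<^sup>2 \<partial>circle_measure) \<le> M"
    and lim: "AE z in circle_measure. (\<lambda>k. h k z) \<longlonglongrightarrow> 0"
  shows "(\<lambda>k. \<integral>z. u z * cnj (h k z) \<partial>circle_measure) \<longlonglongrightarrow> 0"
proof (rule LIMSEQ_I)
  fix e :: real assume e: "0 < e"
  have [measurable]: "u \<in> borel_measurable circle_measure" "h k \<in> borel_measurable circle_measure" for k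
    using u h by (auto simp: square_integrable_def)
  \<comment> \<open>With this threshold the part where \<open>h k\<close> dominates contributes at most \<open>e / 2\<close>.\<close>
  define R where "R = 2 * (\<bar>M\<bar> + 1) / e"
  have R: "R > 0" using e by (simp add: R_def)
  define m where "m = (\<lambda>k z. min (cmod (u z) * cmod (h k z)) (R * (cmod (u z))\<^sup>2))"
  have mm: "m k \<in> borel_measurable circle_measure" for k unfolding m_def by measurable
  have dom: "integrable circle_measure (\<lambda>z. R * (cmod (u z))\<^sup>2)"
    using u by (simp add: square_integrable_def)
  have mb: "norm (m k z) \<le> R * (cmod (u z))\<^sup>2" for k z
    using R by (auto simp: m_def min_def)
  have mi: "integrable circle_measure (m k)" for k
    by (rule Bochner_Integration.integrable_bound[OF dom mm]) (use mb R in auto)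
  have hi: "integrable circle_measure (\<lambda>z. (cmod (h k z))\<^sup>2)" for k
    using h by (simp add: square_integrable_def)
  have "(\<lambda>k. \<integral>z. m k z \<partial>circle_measure) \<longlonglongrightarrow> (\<integral>z. 0 \<partial>circle_measure)"
  proof (rule integral_dominated_convergence[OF _ mm dom])
    show "AE z in circle_measure. (\<lambda>k. m k z) \<longlonglongrightarrow> 0"
      using lim
    proof eventually_elim
      case (elim z)
      have "(\<lambda>k. cmod (u z) * cmod (h k z)) \<longlonglongrightarrow> cmod (u z) * 0"
        using elim by (intro tendsto_mult_left tendsto_norm_zero)
      then have "(\<lambda>k. cmod (u z) * cmod (h k z)) \<longlonglongrightarrow> 0" by simp
      then show ?case
        by (rule Lim_null_comparison[rotated])
           (auto intro!: always_eventually simp: m_def abs_of_nonneg R less_imp_le)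
    qed
  qed (use mb in auto)
  then obtain K where K: "\<And>k. k \<ge> K \<Longrightarrow> \<bar>\<integral>z. m k z \<partial>circle_measure\<bar> < e / 2"
    using LIMSEQ_D[of _ _ "e / 2"] e by fastforce
  show "\<exists>K. \<forall>k\<ge>K. norm ((\<integral>z. u z * cnj (h k z) \<partial>circle_measure) - 0) < e"
  proof (intro exI allI impI)
    fix k assume k: "k \<ge> K"
    have "norm (\<integral>z. u z * cnj (h k z) \<partial>circle_measure)
        \<le> (\<integral>z. norm (u z * cnj (h k z)) \<partial>circle_measure)"
      by (rule integral_norm_bound)
    also have "\<dots> \<le> (\<integral>z. m k z + (cmod (h k z))\<^sup>2 / R \<partial>circle_measure)"
    proof (rule integral_mono)
      show "integrable circle_measure (\<lambda>z. norm (u z * cnj (h k z)))"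
        by (intro integrable_norm square_integrable_mult u square_integrable_cnj h)
      show "integrable circle_measure (\<lambda>z. m k z + (cmod (h k z))\<^sup>2 / R)"
        using mi hi by simp
      fix z
      show "norm (u z * cnj (h k z)) \<le> m k z + (cmod (h k z))\<^sup>2 / R"
      proof (cases "cmod (h k z) \<le> R * cmod (u z)")
        case True
        then have "cmod (u z) * cmod (h k z) \<le> cmod (u z) * (R * cmod (u z))"
          by (intro mult_left_mono) auto
        then have "m k z = cmod (u z) * cmod (h k z)"
          by (simp add: m_def power2_eq_square mult_ac)
        then show ?thesis using R by (simp add: norm_mult)
      next
        case False
        then have "cmod (u z) \<le> cmod (h k z) / R" using R by (simp add: field_simps)
        then have "cmod (u z) * cmod (h k z) \<le> cmod (h k z) / R * cmod (h k z)"
          by (intro mult_right_mono) auto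
        moreover have "0 \<le> m k z" using R by (simp add: m_def)
        ultimately show ?thesis by (simp add: norm_mult power2_eq_square)
      qed
    qed
    also have "\<dots> = (\<integral>z. m k z \<partial>circle_measure) + (\<integral>z. (cmod (h k z))\<^sup>2 \<partial>circle_measure) / R"
      using mi hi by simp
    also have "\<dots> < e / 2 + e / 2"
    proof (rule add_less_le_mono)
      show "(\<integral>z. m k z \<partial>circle_measure) < e / 2" using K[OF k] by simp
      have "(\<integral>z. (cmod (h k z))\<^sup>2 \<partial>circle_measure) / R \<le> (\<bar>M\<bar> + 1) / R"
        using M[of k] R by (intro divide_right_mono) auto
      also have "\<dots> = e / 2" using e by (simp add: R_def field_simps)
      finally show "(\<integral>z. (cmod (h k z))\<^sup>2 \<partial>circle_measure) / R \<le> e / 2" .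
    qed
    finally show "norm ((\<integral>z. u z * cnj (h k z) \<partial>circle_measure) - 0) < e" by simp
  qed
qed

lemma measurable_dilation:
  assumes F: "F holomorphic_on ball 0 1" and r: "0 \<le> r" "r < 1"
  shows "(\<lambda>w. F (of_real r * w)) \<in> borel_measurable circle_measure"
    and "\<exists>B. \<forall>w. cmod w = 1 \<longrightarrow> cmod (F (of_real r * w)) \<le> B"
proof -
  have c: "continuous_on (sphere 0 1) (\<lambda>w. F (of_real r * w))"
  proof (rule continuous_on_compose2[OF holomorphic_on_imp_continuous_on[OF F]])
    show "(\<lambda>w. complex_of_real r * w) ` sphere 0 1 \<subseteq> ball 0 1"
      using r by (auto simp: norm_mult)
  qed (intro continuous_intros)
  show "(\<lambda>w. F (of_real r * w)) \<in> borel_measurable circle_measure"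
    unfolding measurable_circle_eq by (rule borel_measurable_continuous_on_restrict[OF c])
  have "bounded ((\<lambda>w. F (of_real r * w)) ` sphere 0 1)"
    by (intro compact_imp_bounded compact_continuous_image c compact_sphere)
  then obtain B where "\<forall>x\<in>sphere 0 1. cmod (F (of_real r * x)) \<le> B"
    unfolding bounded_iff by auto
  then show "\<exists>B. \<forall>w. cmod w = 1 \<longrightarrow> cmod (F (of_real r * w)) \<le> B"
    by (intro exI[of _ B]) auto
qed

lemma square_integrable_dilation:
  assumes F: "F holomorphic_on ball 0 1" and r: "0 \<le> r" "r < 1"
  shows "square_integrable (\<lambda>w. F (of_real r * w))"
  using measurable_dilation[OF assms] square_integrable_bounded by blast

text \<open>The power series of \<open>F\<close> converges uniformly on the circle of radius \<open>r\<close>, so it can be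
  integrated against \<open>u\<close> term by term.\<close>

lemma dilation_orthogonal:
  assumes F: "F holomorphic_on ball 0 1" and r: "0 \<le> r" "r < 1"
    and u: "square_integrable u" and c: "\<And>n. n \<ge> 0 \<Longrightarrow> fourier u n = 0"
  shows "(\<integral>w. u w * cnj (F (of_real r * w)) \<partial>circle_measure) = 0"
proof -
  define a where "a n = (deriv ^^ n) F 0 / fact n" for n
  have a: "(\<lambda>n. a n * z ^ n) sums F z" if "cmod z < 1" for z
    using holomorphic_power_series[OF F, of z] that by (simp add: a_def)
  have summ: "summable (\<lambda>n. cmod (a n) * r ^ n)"
  proof -
    \<comment> \<open>Convergence at a larger radius gives absolute convergence at \<open>r\<close>.\<close>
    define s where "s = (r + 1) / 2"
    have "summable (\<lambda>n. a n * of_real s ^ n)"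
      using a[of "of_real s"] r by (auto simp: s_def sums_iff)
    then have "summable (\<lambda>n. norm (a n * of_real r ^ n))"
      by (rule powser_insidea) (use r in \<open>auto simp: s_def\<close>)
    then show ?thesis using r by (simp add: norm_mult norm_power)
  qed
  have ui: "integrable circle_measure u" by (rule square_integrable_imp_integrable[OF u])
  let ?f = "\<lambda>n w. u w * (cnj (a n) * (of_real r * cnj w) ^ n)"
  have sq: "square_integrable (\<lambda>w. cnj (a n) * (of_real r * cnj w) ^ n)" for n
  proof (rule square_integrable_bounded)
    show "(\<lambda>w. cnj (a n) * (of_real r * cnj w) ^ n) \<in> borel_measurable circle_measure"
      by (rule borel_measurable_circle) measurable
    show "cmod (cnj (a n) * (of_real r * cnj w) ^ n) \<le> cmod (a n) * r ^ n" if "cmod w = 1" for w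
      using that r by (simp add: norm_mult norm_power)
  qed
  have int: "integrable circle_measure (?f n)" for n
    by (rule square_integrable_mult[OF u sq])
  have z: "(\<integral>w. ?f n w \<partial>circle_measure) = 0" for n
  proof -
    have "(\<integral>w. ?f n w \<partial>circle_measure) =
        (\<integral>w. (cnj (a n) * of_real r ^ n) * (u w * w powi (- int n)) \<partial>circle_measure)"
      by (rule Bochner_Integration.integral_cong)
        (simp_all add: space_circle power_mult_distrib mult_ac flip: cnj_power_eq_powi)
    then show ?thesis using c[of "int n"] by (simp add: fourier_def)
  qed
  have nf: "norm (?f n w) = cmod (u w) * (cmod (a n) * r ^ n)" if "cmod w = 1" for n w
    using that r by (simp add: norm_mult norm_power)
  have "(\<lambda>n. \<integral>w. ?f n w \<partial>circle_measure) sums (\<integral>w. (\<Sum>n. ?f n w) \<partial>circle_measure)"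
  proof (rule sums_integral[OF int])
    show "AE w in circle_measure. summable (\<lambda>n. norm (?f n w))"
      by (rule AE_I2) (use summ in \<open>simp add: nf space_circle summable_mult\<close>)
    have "(\<integral>w. norm (?f n w) \<partial>circle_measure) = (\<integral>w. cmod (u w) * (cmod (a n) * r ^ n) \<partial>circle_measure)" for n
      by (rule Bochner_Integration.integral_cong) (simp_all only: nf space_circle mem_sphere_0)
    then show "summable (\<lambda>n. \<integral>w. norm (?f n w) \<partial>circle_measure)"
      using summ by (simp add: summable_mult)
  qed
  moreover have "(\<integral>w. (\<Sum>n. ?f n w) \<partial>circle_measure) = (\<integral>w. u w * cnj (F (of_real r * w)) \<partial>circle_measure)"
  proof (rule Bochner_Integration.integral_cong)
    fix w assume "w \<in> space circle_measure"
    then have "cmod (of_real r * w) < 1" using r by (simp add: space_circle norm_mult)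
    from a[OF this] have "(\<lambda>n. cnj (a n * (of_real r * w) ^ n)) sums cnj (F (of_real r * w))"
      by (rule sums_cnj[THEN iffD2])
    then have "(\<lambda>n. u w * cnj (a n * (of_real r * w) ^ n)) sums (u w * cnj (F (of_real r * w)))"
      by (rule sums_mult)
    then show "(\<Sum>n. ?f n w) = u w * cnj (F (of_real r * w))" by (simp add: sums_iff)
  qed simp
  ultimately show ?thesis unfolding z by (simp add: sums_iff)
qed

lemma seq_to_one: "filterlim (\<lambda>k. 1 - 1 / (real k + 2)) (at_left 1) sequentially"
  by real_asymp

text \<open>The dilates of \<open>F\<close> have bounded mean squares and converge to \<open>f\<close>, so the orthogonality of
  \<open>u\<close> to the dilates survives in the limit.\<close>

lemma hardy_orthogonal:
  assumes F: "F \<in> hardy_disk" and f: "square_integrable f"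
    and lim: "AE z in circle_measure. ((\<lambda>r. F (of_real r * z)) \<longlongrightarrow> f z) (at_left (1::real))"
    and u: "square_integrable u" and c: "\<And>n. n \<ge> 0 \<Longrightarrow> fourier u n = 0"
  shows "(\<integral>w. u w * cnj (f w) \<partial>circle_measure) = 0"
proof -
  have hol: "F holomorphic_on ball 0 1" using F by (simp add: hardy_disk_def)
  obtain B where "\<forall>r\<in>{0..<1}. (\<integral>z. (cmod (F (of_real r * z)))\<^sup>2 \<partial>circle_measure) \<le> B"
    using F unfolding hardy_disk_def by blast
  then have B: "(\<integral>z. (cmod (F (of_real r * z)))\<^sup>2 \<partial>circle_measure) \<le> B" if "0 \<le> r" "r < 1" for r
    using that by simp
  define \<rho> where "\<rho> k = 1 - 1 / (real k + 2)" for k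
  have \<rho>: "0 \<le> \<rho> k" "\<rho> k < 1" for k by (auto simp: \<rho>_def field_simps)
  define h where "h k z = F (of_real (\<rho> k) * z) - f z" for k z
  have sF: "square_integrable (\<lambda>z. F (of_real (\<rho> k) * z))" for k
    by (rule square_integrable_dilation[OF hol \<rho>])
  have h: "square_integrable (h k)" for k
    using square_integrable_add[OF sF square_integrable_cmult[OF f, of "-1"]] by (simp add: h_def[abs_def])
  have "(\<lambda>k. \<integral>z. u z * cnj (h k z) \<partial>circle_measure) \<longlonglongrightarrow> 0"
  proof (rule weakly_null[OF u h])
    fix k
    have Fi: "integrable circle_measure (\<lambda>z. (cmod (F (of_real (\<rho> k) * z)))\<^sup>2)"
      and fi: "integrable circle_measure (\<lambda>z. (cmod (f z))\<^sup>2)"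
      using sF f by (auto simp: square_integrable_def)
    have "(\<integral>z. (cmod (h k z))\<^sup>2 \<partial>circle_measure) \<le>
        (\<integral>z. 2 * (cmod (F (of_real (\<rho> k) * z)))\<^sup>2 + 2 * (cmod (f z))\<^sup>2 \<partial>circle_measure)"
    proof (rule integral_mono)
      show "integrable circle_measure (\<lambda>z. (cmod (h k z))\<^sup>2)"
        using h by (simp add: square_integrable_def)
      fix z
      let ?x = "cmod (F (of_real (\<rho> k) * z))" and ?y = "cmod (f z)"
      have "(cmod (h k z))\<^sup>2 \<le> (?x + ?y)\<^sup>2"
        unfolding h_def by (intro power_mono norm_triangle_ineq4) auto
      also have "\<dots> \<le> 2 * ?x\<^sup>2 + 2 * ?y\<^sup>2"
        using sum_squares_bound[of ?x ?y] by (simp add: power2_sum)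
      finally show "(cmod (h k z))\<^sup>2 \<le> 2 * ?x\<^sup>2 + 2 * ?y\<^sup>2" .
    qed (use Fi fi in auto)
    also have "\<dots> \<le> 2 * B + 2 * (\<integral>z. (cmod (f z))\<^sup>2 \<partial>circle_measure)"
      using Fi fi B[OF \<rho>, of k] by simp
    finally show "(\<integral>z. (cmod (h k z))\<^sup>2 \<partial>circle_measure)
        \<le> 2 * B + 2 * (\<integral>z. (cmod (f z))\<^sup>2 \<partial>circle_measure)" .
  next
    show "AE z in circle_measure. (\<lambda>k. h k z) \<longlonglongrightarrow> 0"
      using lim
    proof eventually_elim
      case (elim z)
      have "(\<lambda>k. F (of_real (\<rho> k) * z)) \<longlonglongrightarrow> f z"
        using filterlim_compose[OF elim seq_to_one] by (simp add: \<rho>_def)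
      then show ?case unfolding h_def by (simp add: LIM_zero_iff)
    qed
  qed
  moreover have "(\<integral>z. u z * cnj (h k z) \<partial>circle_measure) = - (\<integral>w. u w * cnj (f w) \<partial>circle_measure)" for k
  proof -
    have "(\<integral>z. u z * cnj (h k z) \<partial>circle_measure) =
        (\<integral>z. u z * cnj (F (of_real (\<rho> k) * z)) - u z * cnj (f z) \<partial>circle_measure)"
      by (simp add: h_def algebra_simps)
    also have "\<dots> = (\<integral>z. u z * cnj (F (of_real (\<rho> k) * z)) \<partial>circle_measure) - (\<integral>z. u z * cnj (f z) \<partial>circle_measure)"
      by (intro Bochner_Integration.integral_diff square_integrable_mult square_integrable_cnj u f sF)
    finally show ?thesis using dilation_orthogonal[OF hol \<rho> u c] by simp
  qed
  ultimately show ?thesis by (simp add: LIMSEQ_const_iff)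
qed

lemma norm_sum_powers:
  "(\<integral>w. (cmod (\<Sum>n<N. b n * w ^ n))\<^sup>2 \<partial>circle_measure) = (\<Sum>n<N. (cmod (b n))\<^sup>2)"
proof -
  have int: "integrable circle_measure (\<lambda>w. b n * cnj (b m) * w powi (int n - int m))" for n m
    by (intro integrable_mult_right square_integrable_imp_integrable square_integrable_powi)
  have "complex_of_real (\<integral>w. (cmod (\<Sum>n<N. b n * w ^ n))\<^sup>2 \<partial>circle_measure) =
      (\<integral>w. complex_of_real ((cmod (\<Sum>n<N. b n * w ^ n))\<^sup>2) \<partial>circle_measure)"
    by (rule integral_complex_of_real[symmetric])
  also have "\<dots> = (\<integral>w. (\<Sum>n<N. \<Sum>m<N. b n * cnj (b m) * w powi (int n - int m)) \<partial>circle_measure)"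
  proof (rule Bochner_Integration.integral_cong)
    fix w assume w: "w \<in> space circle_measure"
    then have "w \<noteq> 0" by (auto simp: space_circle)
    then have pw: "w ^ n * cnj w ^ m = w powi (int n - int m)" for n m
      using w power_int_add[of w "int n" "- int m"] by (simp add: space_circle cnj_power_eq_powi)
    have "complex_of_real ((cmod (\<Sum>n<N. b n * w ^ n))\<^sup>2) =
        (\<Sum>n<N. b n * w ^ n) * (\<Sum>m<N. cnj (b m) * cnj w ^ m)"
      unfolding complex_norm_square by (simp add: cnj_sum)
    also have "\<dots> = (\<Sum>n<N. \<Sum>m<N. b n * cnj (b m) * (w ^ n * cnj w ^ m))"
      by (simp add: sum_product mult_ac)
    finally show "complex_of_real ((cmod (\<Sum>n<N. b n * w ^ n))\<^sup>2) =
        (\<Sum>n<N. \<Sum>m<N. b n * cnj (b m) * w powi (int n - int m))"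
      unfolding pw .
  qed simp
  also have "\<dots> = (\<Sum>n<N. \<Sum>m<N. \<integral>w. b n * cnj (b m) * w powi (int n - int m) \<partial>circle_measure)"
    using int by (simp only: Bochner_Integration.integral_sum Bochner_Integration.integrable_sum)
  also have "\<dots> = (\<Sum>n<N. \<Sum>m<N. if n = m then b n * cnj (b m) else 0)"
    by (intro sum.cong refl) (simp add: integral_circle_powi)
  also have "\<dots> = (\<Sum>n<N. b n * cnj (b n))" by (simp add: sum.delta)
  also have "\<dots> = complex_of_real (\<Sum>n<N. (cmod (b n))\<^sup>2)" by (simp add: complex_norm_square[symmetric])
  finally show ?thesis using of_real_eq_iff by blast
qed

lemma bessel:
  assumes f: "square_integrable f"
  shows "(\<Sum>n<N. (cmod (fourier f (int n)))\<^sup>2) \<le> (\<integral>w. (cmod (f w))\<^sup>2 \<partial>circle_measure)"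
proof -
  define c where "c n = fourier f (int n)" for n
  define S where "S w = (\<Sum>n<N. c n * w ^ n)" for w
  have S: "square_integrable S"
    unfolding S_def[abs_def]
  proof (rule square_integrable_bounded)
    show "(\<lambda>w. \<Sum>n<N. c n * w ^ n) \<in> borel_measurable circle_measure"
      by (rule borel_measurable_circle) measurable
    show "cmod (\<Sum>n<N. c n * w ^ n) \<le> (\<Sum>n<N. cmod (c n))" if "cmod w = 1" for w
      using that by (intro sum_norm_le) (simp add: norm_mult norm_power)
  qed
  have fS: "(\<integral>w. f w * cnj (S w) \<partial>circle_measure) = of_real (\<Sum>n<N. (cmod (c n))\<^sup>2)"
  proof -
    have int: "integrable circle_measure (\<lambda>w. cnj (c n) * (f w * w powi (- int n)))" for n
      by (intro integrable_mult_right square_integrable_mult f square_integrable_powi)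
    have "(\<integral>w. f w * cnj (S w) \<partial>circle_measure) =
        (\<integral>w. (\<Sum>n<N. cnj (c n) * (f w * w powi (- int n))) \<partial>circle_measure)"
      by (rule Bochner_Integration.integral_cong)
        (simp_all add: S_def space_circle cnj_sum sum_distrib_left mult_ac flip: cnj_power_eq_powi)
    also have "\<dots> = (\<Sum>n<N. \<integral>w. cnj (c n) * (f w * w powi (- int n)) \<partial>circle_measure)"
      by (rule Bochner_Integration.integral_sum) (rule int)
    also have "\<dots> = (\<Sum>n<N. cnj (c n) * c n)" by (simp add: c_def fourier_def)
    also have "\<dots> = of_real (\<Sum>n<N. (cmod (c n))\<^sup>2)"
      unfolding of_real_sum complex_norm_square by (simp add: mult.commute)
    finally show ?thesis .
  qed
  have i1: "integrable circle_measure (\<lambda>w. (cmod (f w))\<^sup>2)"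
    and i2: "integrable circle_measure (\<lambda>w. (cmod (S w))\<^sup>2)"
    using f S by (auto simp: square_integrable_def)
  have i3: "integrable circle_measure (\<lambda>w. f w * cnj (S w))"
    by (intro square_integrable_mult square_integrable_cnj f S)
  have i4: "integrable circle_measure (\<lambda>w. 2 * Re (f w * cnj (S w)))"
    by (intro integrable_mult_right integrable_Re i3)
  have "0 \<le> (\<integral>w. (cmod (f w - S w))\<^sup>2 \<partial>circle_measure)" by simp
  also have "\<dots> = (\<integral>w. (cmod (f w))\<^sup>2 - 2 * Re (f w * cnj (S w)) + (cmod (S w))\<^sup>2 \<partial>circle_measure)"
  proof -
    have "(cmod (a - b))\<^sup>2 = (cmod a)\<^sup>2 - 2 * Re (a * cnj b) + (cmod b)\<^sup>2" for a b
      unfolding cmod_power2 by (simp add: power2_eq_square algebra_simps)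
    then show ?thesis by simp
  qed
  also have "\<dots> = (\<integral>w. (cmod (f w))\<^sup>2 \<partial>circle_measure) - 2 * Re (\<integral>w. f w * cnj (S w) \<partial>circle_measure)
      + (\<integral>w. (cmod (S w))\<^sup>2 \<partial>circle_measure)"
    by (simp only: Bochner_Integration.integral_add[OF Bochner_Integration.integrable_diff[OF i1 i4] i2]
        Bochner_Integration.integral_diff[OF i1 i4] integral_mult_right_zero integral_Re[OF i3])
  finally show ?thesis
    unfolding fS unfolding S_def norm_sum_powers by (simp add: c_def)
qed

text \<open>Without negative frequencies the Poisson integral of \<open>f\<close> is the power series whose
  coefficients are the Fourier coefficients, so Fatou's theorem gives its radial limits; Bessel's
  inequality bounds its means on circles.\<close>

lemma hardy_extension:
  assumes f: "square_integrable f" and neg: "\<And>n. n < 0 \<Longrightarrow> fourier f n = 0"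
  shows "\<exists>F\<in>hardy_disk. AE z in circle_measure.
    ((\<lambda>r. F (of_real r * z)) \<longlongrightarrow> f z) (at_left (1::real))"
proof -
  have fi: "integrable circle_measure f" by (rule square_integrable_imp_integrable[OF f])
  define c where "c n = fourier f (int n)" for n
  define C where "C = (\<integral>w. (cmod (f w))\<^sup>2 \<partial>circle_measure)"
  have cb: "cmod (c n) \<le> 1 + C" for n
  proof -
    have "(cmod (c n))\<^sup>2 \<le> (\<Sum>k<Suc n. (cmod (c k))\<^sup>2)" by (simp add: sum_nonneg)
    also have "\<dots> \<le> C" unfolding c_def C_def by (rule bessel[OF f])
    finally have "(cmod (c n))\<^sup>2 \<le> C" .
    moreover have "0 \<le> (cmod (c n) - 1)\<^sup>2" by simp
    moreover have "0 \<le> C" by (simp add: C_def)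
    ultimately show ?thesis by (simp add: power2_diff)
  qed
  have abs: "summable (\<lambda>n. cmod (c n * z ^ n))" if "cmod z < 1" for z
  proof (rule summable_comparison_test')
    show "summable (\<lambda>n. (1 + C) * cmod z ^ n)"
      using that by (intro summable_mult summable_geometric) auto
    show "norm (cmod (c n * z ^ n)) \<le> (1 + C) * cmod z ^ n" for n
      using cb[of n] by (simp add: norm_mult norm_power mult_right_mono)
  qed
  define F where "F z = (\<Sum>n. c n * z ^ n)" for z
  have sumsF: "(\<lambda>n. c n * z ^ n) sums F z" if "cmod z < 1" for z
    unfolding F_def using summable_norm_cancel[OF abs[OF that]] by (rule summable_sums)
  have hol: "F holomorphic_on ball 0 1"
    by (rule power_series_holomorphic[where a = c]) (use sumsF in auto)
  have "(\<integral>z. (cmod (F (of_real r * z)))\<^sup>2 \<partial>circle_measure) \<le> C" if r: "0 \<le> r" "r < 1" for r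
  proof (rule LIMSEQ_le_const2)
    let ?S = "\<lambda>N w. \<Sum>n<N. (c n * of_real r ^ n) * w ^ n"
    define Q where "Q = (\<Sum>n. cmod (c n * of_real r ^ n))"
    have Q: "cmod (?S N w) \<le> Q" if "cmod w = 1" for N w
    proof -
      have "cmod (?S N w) \<le> (\<Sum>n<N. cmod (c n * of_real r ^ n))"
        using that by (intro sum_norm_le) (simp add: norm_mult norm_power)
      also have "\<dots> \<le> Q"
        unfolding Q_def by (rule sum_le_suminf) (use abs[of "of_real r"] r in auto)
      finally show ?thesis .
    qed
    show "(\<lambda>N. \<integral>w. (cmod (?S N w))\<^sup>2 \<partial>circle_measure) \<longlonglongrightarrow>
        (\<integral>z. (cmod (F (of_real r * z)))\<^sup>2 \<partial>circle_measure)"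
    proof (rule integral_dominated_convergence[where w = "\<lambda>_. Q\<^sup>2"])
      show "(\<lambda>z. (cmod (F (of_real r * z)))\<^sup>2) \<in> borel_measurable circle_measure"
        using measurable_dilation(1)[OF hol r] by measurable
      show "(\<lambda>w. (cmod (?S N w))\<^sup>2) \<in> borel_measurable circle_measure" for N
        by (rule borel_measurable_circle) measurable
      show "AE w in circle_measure. (\<lambda>N. (cmod (?S N w))\<^sup>2) \<longlonglongrightarrow> (cmod (F (of_real r * w)))\<^sup>2"
      proof (rule AE_I2)
        fix w assume "w \<in> space circle_measure"
        then have "cmod (of_real r * w) < 1" using r by (simp add: space_circle norm_mult)
        from sumsF[OF this] have "(\<lambda>N. ?S N w) \<longlonglongrightarrow> F (of_real r * w)"
          by (simp add: sums_def power_mult_distrib mult_ac)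
        then show "(\<lambda>N. (cmod (?S N w))\<^sup>2) \<longlonglongrightarrow> (cmod (F (of_real r * w)))\<^sup>2"
          by (intro tendsto_intros)
      qed
      show "AE w in circle_measure. norm ((cmod (?S N w))\<^sup>2) \<le> Q\<^sup>2" for N
        by (rule AE_I2) (use Q in \<open>auto simp: space_circle intro!: power_mono\<close>)
    qed simp
    have "(\<integral>w. (cmod (?S N w))\<^sup>2 \<partial>circle_measure) \<le> C" for N
    proof -
      have "(\<Sum>n<N. (cmod (c n * of_real r ^ n))\<^sup>2) \<le> (\<Sum>n<N. (cmod (c n))\<^sup>2)"
        using r by (intro sum_mono power_mono)
          (auto simp: norm_mult norm_power mult_left_le power_le_one)
      also have "\<dots> \<le> C" unfolding c_def C_def by (rule bessel[OF f])
      finally show ?thesis by (simp only: norm_sum_powers)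
    qed
    then show "\<exists>N0. \<forall>N\<ge>N0. (\<integral>w. (cmod (?S N w))\<^sup>2 \<partial>circle_measure) \<le> C" by blast
  qed
  then have "\<forall>r\<in>{0..<1}. (\<integral>z. (cmod (F (of_real r * z)))\<^sup>2 \<partial>circle_measure) \<le> C"
    by simp
  with hol have "F \<in> hardy_disk" unfolding hardy_disk_def by blast
  moreover have "AE z in circle_measure. ((\<lambda>r. F (of_real r * z)) \<longlongrightarrow> f z) (at_left (1::real))"
    using poisson_tendsto_AE[OF fi] AE_circle_norm
  proof eventually_elim
    case (elim z)
    have eq: "poisson f r z = F (of_real r * z)" if r: "0 \<le> r" "r < 1" for r
    proof -
      note P = poisson_series[OF fi r elim(2)]
      have "cmod (of_real r * z) < 1" using r elim(2) by (simp add: norm_mult)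
      from sumsF[OF this] have 1: "(\<integral>w. f w / (1 - of_real r * z * cnj w) \<partial>circle_measure) = F (of_real r * z)"
        using P(1) by (simp add: c_def sums_iff mult.commute)
      have "(\<lambda>n. (of_real r * cnj z) ^ n * fourier f (- int n)) sums fourier f 0"
        using sums_single[of 0 "\<lambda>_. fourier f 0"]
        by (rule sums_cong[THEN iffD1, rotated]) (auto simp: neg)
      then have "(\<integral>w. f w / (1 - of_real r * cnj z * w) \<partial>circle_measure) = fourier f 0"
        using P(2) by (simp add: sums_iff)
      with 1 show ?thesis unfolding P(3) by simp
    qed
    have "\<forall>\<^sub>F r in at_left (1::real). poisson f r z = F (of_real r * z)"
      by (rule eventually_at_leftI[of 0]) (auto intro!: eq)
    then show ?case using elim(1) by (rule Lim_transform_eventually[rotated])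
  qed
  ultimately show ?thesis by blast
qed

section \<open>The Hilbert space structure of $L^2$\<close>

lemma l2_rel_self: "l2_rel f f \<longleftrightarrow> square_integrable f"
  by (simp add: l2_rel_def)

lemma square_integrable_rep [simp]: "square_integrable (rep_l2 f)"
  using Quotient3_rep_reflp[OF Quotient3_l2, of f] by (simp add: l2_rel_def)

lemma abs_rep_l2: "abs_l2 (rep_l2 f) = f"
  by (rule Quotient3_abs_rep[OF Quotient3_l2])

lemma abs_l2_eqI: "l2_rel f g \<Longrightarrow> abs_l2 f = abs_l2 g"
  by (rule Quotient3_rel_abs[OF Quotient3_l2])

lemma rep_abs_l2:
  assumes "square_integrable f" shows "AE z in circle_measure. rep_l2 (abs_l2 f) z = f z"
proof -
  have "l2_rel f (rep_l2 (abs_l2 f))"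
    by (rule rep_abs_rsp[OF Quotient3_l2]) (use assms in \<open>simp add: l2_rel_self\<close>)
  then show ?thesis by (auto simp: l2_rel_def eq_commute)
qed

lemma l2_eqI: "AE z in circle_measure. rep_l2 f z = rep_l2 g z \<Longrightarrow> f = g"
  using abs_l2_eqI[of "rep_l2 f" "rep_l2 g"] by (simp add: l2_rel_def abs_rep_l2)

lemma rep_l2_add: "AE z in circle_measure. rep_l2 (f + g) z = rep_l2 f z + rep_l2 g z"
proof -
  have "f + g = abs_l2 (\<lambda>z. rep_l2 f z + rep_l2 g z)"
    using plus_l2.abs_eq[of "rep_l2 f" "rep_l2 g"] by (simp add: l2_rel_self abs_rep_l2)
  then show ?thesis by (simp add: rep_abs_l2 square_integrable_add)
qed

lemma rep_l2_scaleC: "AE z in circle_measure. rep_l2 (c *\<^sub>C f) z = c * rep_l2 f z"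
proof -
  have "c *\<^sub>C f = abs_l2 (\<lambda>z. c * rep_l2 f z)"
    using scaleC.abs_eq[of "rep_l2 f" c] by (simp add: l2_rel_self abs_rep_l2)
  then show ?thesis by (simp add: rep_abs_l2 square_integrable_cmult)
qed

lemma uminus_l2_eq_scaleC: "- f = (-1) *\<^sub>C f"
  using uminus_l2.abs_eq[of "rep_l2 f"] scaleC.abs_eq[of "rep_l2 f" "-1"]
  by (simp add: l2_rel_self abs_rep_l2)

lemma cinner_eq: "cinner f g = (\<integral>z. rep_l2 f z * cnj (rep_l2 g z) \<partial>circle_measure)"
  using cinner.abs_eq[of "rep_l2 f" "rep_l2 g"] by (simp add: l2_rel_self abs_rep_l2)

lemma integrable_cinner: "integrable circle_measure (\<lambda>z. rep_l2 f z * cnj (rep_l2 g z))"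
  by (intro square_integrable_mult square_integrable_cnj square_integrable_rep)

lemma measurable_rep_l2 [measurable]: "rep_l2 f \<in> borel_measurable circle_measure"
  by (rule square_integrable_measurable) simp

lemma cinner_cong:
  assumes "AE z in circle_measure. rep_l2 f z * cnj (rep_l2 g z) = h z"
    and "h \<in> borel_measurable circle_measure"
  shows "cinner f g = (\<integral>z. h z \<partial>circle_measure)"
  unfolding cinner_eq by (rule integral_cong_AE) (use assms in \<open>auto intro!: borel_measurable_times measurable_cnj\<close>)

lemma cinner_commute: "cinner g f = cnj (cinner f g)"
proof -
  have "cinner g f = (\<integral>z. cnj (rep_l2 f z * cnj (rep_l2 g z)) \<partial>circle_measure)"
    unfolding cinner_eq by (simp add: mult.commute)
  also have "\<dots> = cnj (cinner f g)"
    unfolding cinner_eq by (rule Bochner_Integration.integral_cnj)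
  finally show ?thesis .
qed

lemma cinner_add_left: "cinner (f + g) h = cinner f h + cinner g h"
proof -
  have "cinner (f + g) h =
      (\<integral>z. rep_l2 f z * cnj (rep_l2 h z) + rep_l2 g z * cnj (rep_l2 h z) \<partial>circle_measure)"
  proof (rule cinner_cong)
    show "AE z in circle_measure. rep_l2 (f + g) z * cnj (rep_l2 h z) =
        rep_l2 f z * cnj (rep_l2 h z) + rep_l2 g z * cnj (rep_l2 h z)"
      using rep_l2_add[of f g] by eventually_elim (simp add: algebra_simps)
  qed (use integrable_cinner in \<open>auto intro!: borel_measurable_add\<close>)
  then show ?thesis by (simp add: cinner_eq integrable_cinner)
qed

lemma cinner_scaleC_left: "cinner (c *\<^sub>C f) h = c * cinner f h"
proof -
  have "cinner (c *\<^sub>C f) h = (\<integral>z. c * (rep_l2 f z * cnj (rep_l2 h z)) \<partial>circle_measure)"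
  proof (rule cinner_cong)
    show "AE z in circle_measure. rep_l2 (c *\<^sub>C f) z * cnj (rep_l2 h z) =
        c * (rep_l2 f z * cnj (rep_l2 h z))"
      using rep_l2_scaleC[of c f] by eventually_elim simp
  qed (use integrable_cinner in \<open>auto intro!: borel_measurable_times\<close>)
  then show ?thesis by (simp add: cinner_eq)
qed

lemma cinner_minus_left: "cinner (- f) h = - cinner f h"
  by (simp add: uminus_l2_eq_scaleC cinner_scaleC_left)

lemma cinner_diff_left: "cinner (f - g) h = cinner f h - cinner g h"
  by (simp only: diff_conv_add_uminus cinner_add_left cinner_minus_left)

lemma cinner_scaleC_right: "cinner f (c *\<^sub>C h) = cnj c * cinner f h"
  using cinner_scaleC_left[of c h f] by (simp add: cinner_commute[of f])

lemma cinner_diff_right: "cinner f (g - h) = cinner f g - cinner f h"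
  using cinner_diff_left[of g h f] by (simp add: cinner_commute[of f])

lemma cinner_zero_right [simp]: "cinner f 0 = 0"
  using cinner_diff_right[of f 0 0] by simp

lemma cinner_definite:
  assumes "cinner f f = 0" shows "f = 0"
proof -
  have int: "integrable circle_measure (\<lambda>z. (cmod (rep_l2 f z))\<^sup>2)"
    using square_integrable_rep[of f] by (simp only: square_integrable_def)
  have "complex_of_real (\<integral>z. (cmod (rep_l2 f z))\<^sup>2 \<partial>circle_measure) = cinner f f"
    unfolding cinner_eq complex_norm_square[symmetric] by (rule integral_complex_of_real[symmetric])
  then have "(\<integral>z. (cmod (rep_l2 f z))\<^sup>2 \<partial>circle_measure) = 0"
    using assms by simp
  then have "AE z in circle_measure. (cmod (rep_l2 f z))\<^sup>2 = 0"
    using integral_nonneg_eq_0_iff_AE[OF int] by simp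
  moreover have "AE z in circle_measure. rep_l2 0 z = 0"
    using rep_abs_l2[OF square_integrable_zero] by (simp only: zero_l2_def)
  ultimately have "AE z in circle_measure. rep_l2 f z = rep_l2 0 z"
    by eventually_elim simp
  then show ?thesis by (rule l2_eqI)
qed

lemma scaleC_scaleC: "a *\<^sub>C b *\<^sub>C f = (a * b) *\<^sub>C f"
proof (rule l2_eqI)
  show "AE z in circle_measure. rep_l2 (a *\<^sub>C b *\<^sub>C f) z = rep_l2 ((a * b) *\<^sub>C f) z"
    using rep_l2_scaleC[of a "b *\<^sub>C f"] rep_l2_scaleC[of b f] rep_l2_scaleC[of "a * b" f]
    by eventually_elim simp
qed

lemma scaleC_one: "1 *\<^sub>C f = f"
  by (rule l2_eqI) (use rep_l2_scaleC[of 1 f] in simp)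

lemma scaleC_add_right: "a *\<^sub>C (f + g) = a *\<^sub>C f + a *\<^sub>C g"
proof (rule l2_eqI)
  show "AE z in circle_measure. rep_l2 (a *\<^sub>C (f + g)) z = rep_l2 (a *\<^sub>C f + a *\<^sub>C g) z"
    using rep_l2_scaleC[of a "f + g"] rep_l2_add[of f g] rep_l2_add[of "a *\<^sub>C f" "a *\<^sub>C g"]
      rep_l2_scaleC[of a f] rep_l2_scaleC[of a g]
    by eventually_elim (simp add: algebra_simps)
qed

lemma scaleC_diff_right: "a *\<^sub>C (f - g) = a *\<^sub>C f - a *\<^sub>C g"
proof -
  have D: "x - y = x + (-1) *\<^sub>C y" for x y by (simp flip: uminus_l2_eq_scaleC)
  show ?thesis unfolding D scaleC_add_right scaleC_scaleC by simp
qed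

lemma scaleC_zero [simp]: "a *\<^sub>C 0 = 0"
  using scaleC_add_right[of a 0 0] by simp

section \<open>Multiplication by unimodular functions\<close>

definition unimodular :: "(complex \<Rightarrow> complex) \<Rightarrow> bool" where
  "unimodular \<phi> \<longleftrightarrow> \<phi> \<in> borel_measurable circle_measure \<and> (AE z in circle_measure. cmod (\<phi> z) = 1)"

lemma unimodular_mult: "unimodular \<phi> \<Longrightarrow> unimodular \<psi> \<Longrightarrow> unimodular (\<lambda>z. \<phi> z * \<psi> z)"
  unfolding unimodular_def
  by (auto intro!: borel_measurable_times elim!: AE_mp simp: norm_mult)

lemma unimodular_cnj: "unimodular \<phi> \<Longrightarrow> unimodular (\<lambda>z. cnj (\<phi> z))"
  unfolding unimodular_def by (auto intro!: measurable_cnj)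

lemma unimodular_powi: "unimodular (\<lambda>z. z powi n)"
  unfolding unimodular_def
  using borel_measurable_circle[OF borel_measurable_powi[of "\<lambda>z. z" borel n]] AE_circle_norm
  by (auto simp: norm_power_int elim!: AE_mp)

lemma unimodular_ident: "unimodular (\<lambda>z. z)"
  using unimodular_powi[of 1] by simp

lemma square_integrable_unimodular_mult:
  assumes "unimodular \<phi>" "square_integrable f"
  shows "square_integrable (\<lambda>z. \<phi> z * f z)"
proof -
  have [measurable]: "\<phi> \<in> borel_measurable circle_measure" "f \<in> borel_measurable circle_measure"
    using assms by (auto simp: unimodular_def square_integrable_def)
  have "AE z in circle_measure. (cmod (\<phi> z * f z))\<^sup>2 = (cmod (f z))\<^sup>2"
    using assms unfolding unimodular_def by (auto simp: norm_mult elim!: AE_mp)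
  then have "integrable circle_measure (\<lambda>z. (cmod (\<phi> z * f z))\<^sup>2) \<longleftrightarrow>
      integrable circle_measure (\<lambda>z. (cmod (f z))\<^sup>2)"
    by (intro integrable_cong_AE) auto
  then show ?thesis using assms by (simp add: square_integrable_def)
qed

lemma rep_mult_l2:
  "unimodular \<phi> \<Longrightarrow> AE z in circle_measure. rep_l2 (mult_l2 \<phi> f) z = \<phi> z * rep_l2 f z"
  unfolding mult_l2_def by (rule rep_abs_l2) (simp add: square_integrable_unimodular_mult)

lemma mult_l2_cong:
  assumes "unimodular \<phi>" "unimodular \<psi>" "AE z in circle_measure. \<phi> z = \<psi> z"
  shows "mult_l2 \<phi> f = mult_l2 \<psi> f"
proof (rule l2_eqI)
  show "AE z in circle_measure. rep_l2 (mult_l2 \<phi> f) z = rep_l2 (mult_l2 \<psi> f) z"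
    using rep_mult_l2[OF assms(1), of f] rep_mult_l2[OF assms(2), of f] assms(3)
    by eventually_elim simp
qed

lemma mult_l2_mult:
  assumes "unimodular \<phi>" "unimodular \<psi>"
  shows "mult_l2 \<phi> (mult_l2 \<psi> f) = mult_l2 (\<lambda>z. \<phi> z * \<psi> z) f"
proof (rule l2_eqI)
  show "AE z in circle_measure. rep_l2 (mult_l2 \<phi> (mult_l2 \<psi> f)) z = rep_l2 (mult_l2 (\<lambda>z. \<phi> z * \<psi> z) f) z"
    using rep_mult_l2[OF assms(1), of "mult_l2 \<psi> f"] rep_mult_l2[OF assms(2), of f]
      rep_mult_l2[OF unimodular_mult[OF assms], of f]
    by eventually_elim simp
qed

lemma mult_l2_one: "mult_l2 (\<lambda>_. 1) f = f"
  by (simp add: mult_l2_def abs_rep_l2)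

lemma mult_l2_cancel:
  assumes "unimodular \<phi>"
  shows "mult_l2 \<phi> (mult_l2 (\<lambda>z. cnj (\<phi> z)) f) = f" "mult_l2 (\<lambda>z. cnj (\<phi> z)) (mult_l2 \<phi> f) = f"
proof -
  have one: "unimodular (\<lambda>_. 1)" by (simp add: unimodular_def)
  have c: "AE z in circle_measure. \<phi> z * cnj (\<phi> z) = 1"
    using assms unfolding unimodular_def by (auto simp: complex_norm_square[symmetric] elim!: AE_mp)
  show "mult_l2 \<phi> (mult_l2 (\<lambda>z. cnj (\<phi> z)) f) = f"
    using mult_l2_cong[OF unimodular_mult[OF assms unimodular_cnj[OF assms]] one c, of f]
    by (simp add: mult_l2_mult[OF assms unimodular_cnj[OF assms]] mult_l2_one)
  show "mult_l2 (\<lambda>z. cnj (\<phi> z)) (mult_l2 \<phi> f) = f"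
    using mult_l2_cong[OF unimodular_mult[OF assms unimodular_cnj[OF assms]] one c, of f]
    by (simp add: mult_l2_mult[OF unimodular_cnj[OF assms] assms] mult_l2_one mult.commute)
qed

lemma mult_l2_add:
  assumes "unimodular \<phi>"
  shows "mult_l2 \<phi> (f + g) = mult_l2 \<phi> f + mult_l2 \<phi> g"
proof (rule l2_eqI)
  show "AE z in circle_measure. rep_l2 (mult_l2 \<phi> (f + g)) z = rep_l2 (mult_l2 \<phi> f + mult_l2 \<phi> g) z"
    using rep_mult_l2[OF assms, of "f + g"] rep_l2_add[of f g] rep_l2_add[of "mult_l2 \<phi> f" "mult_l2 \<phi> g"]
      rep_mult_l2[OF assms, of f] rep_mult_l2[OF assms, of g]
    by eventually_elim (simp add: algebra_simps)
qed

lemma mult_l2_scaleC: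
  assumes "unimodular \<phi>"
  shows "mult_l2 \<phi> (c *\<^sub>C f) = c *\<^sub>C mult_l2 \<phi> f"
proof (rule l2_eqI)
  show "AE z in circle_measure. rep_l2 (mult_l2 \<phi> (c *\<^sub>C f)) z = rep_l2 (c *\<^sub>C mult_l2 \<phi> f) z"
    using rep_mult_l2[OF assms, of "c *\<^sub>C f"] rep_l2_scaleC[of c f] rep_l2_scaleC[of c "mult_l2 \<phi> f"]
      rep_mult_l2[OF assms, of f]
    by eventually_elim simp
qed

lemma mult_l2_diff:
  assumes "unimodular \<phi>"
  shows "mult_l2 \<phi> (f - g) = mult_l2 \<phi> f - mult_l2 \<phi> g"
  using mult_l2_add[OF assms, of f "- g"] mult_l2_scaleC[OF assms, of "-1" g]
  by (simp flip: uminus_l2_eq_scaleC)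

lemma cinner_mult_l2:
  assumes "unimodular \<phi>"
  shows "cinner (mult_l2 \<phi> f) (mult_l2 \<phi> g) = cinner f g"
proof -
  have "AE z in circle_measure. \<phi> z * cnj (\<phi> z) = 1"
    using assms unfolding unimodular_def by (auto simp: complex_norm_square[symmetric] elim!: AE_mp)
  then have "AE z in circle_measure. rep_l2 (mult_l2 \<phi> f) z * cnj (rep_l2 (mult_l2 \<phi> g) z) =
      rep_l2 f z * cnj (rep_l2 g z)"
    using rep_mult_l2[OF assms, of f] rep_mult_l2[OF assms, of g]
  proof eventually_elim
    case (elim z)
    have "rep_l2 (mult_l2 \<phi> f) z * cnj (rep_l2 (mult_l2 \<phi> g) z) =
        (\<phi> z * cnj (\<phi> z)) * (rep_l2 f z * cnj (rep_l2 g z))"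
      unfolding elim(2,3) by simp
    then show ?case unfolding elim(1) by simp
  qed
  then show ?thesis
    unfolding cinner_eq[of f g] by (rule cinner_cong) (use integrable_cinner in auto)
qed

lemma cinner_mult_l2_right:
  assumes "unimodular \<phi>"
  shows "cinner f (mult_l2 \<phi> g) = cinner (mult_l2 (\<lambda>z. cnj (\<phi> z)) f) g"
  using cinner_mult_l2[OF assms, of "mult_l2 (\<lambda>z. cnj (\<phi> z)) f" g]
  by (simp add: mult_l2_cancel[OF assms])

definition conj_l2 :: "l2 \<Rightarrow> l2" where
  "conj_l2 f = abs_l2 (\<lambda>z. cnj (rep_l2 f z))"

lemma rep_conj_l2: "AE z in circle_measure. rep_l2 (conj_l2 f) z = cnj (rep_l2 f z)"
  unfolding conj_l2_def by (rule rep_abs_l2) (simp add: square_integrable_cnj)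

lemma conj_l2_add: "conj_l2 (f + g) = conj_l2 f + conj_l2 g"
proof (rule l2_eqI)
  show "AE z in circle_measure. rep_l2 (conj_l2 (f + g)) z = rep_l2 (conj_l2 f + conj_l2 g) z"
    using rep_conj_l2[of "f + g"] rep_l2_add[of f g] rep_l2_add[of "conj_l2 f" "conj_l2 g"]
      rep_conj_l2[of f] rep_conj_l2[of g]
    by eventually_elim simp
qed

lemma conj_l2_scaleC: "conj_l2 (c *\<^sub>C f) = cnj c *\<^sub>C conj_l2 f"
proof (rule l2_eqI)
  show "AE z in circle_measure. rep_l2 (conj_l2 (c *\<^sub>C f)) z = rep_l2 (cnj c *\<^sub>C conj_l2 f) z"
    using rep_conj_l2[of "c *\<^sub>C f"] rep_l2_scaleC[of c f] rep_l2_scaleC[of "cnj c" "conj_l2 f"]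
      rep_conj_l2[of f]
    by eventually_elim simp
qed

lemma conj_l2_conj_l2: "conj_l2 (conj_l2 f) = f"
proof (rule l2_eqI)
  show "AE z in circle_measure. rep_l2 (conj_l2 (conj_l2 f)) z = rep_l2 f z"
    using rep_conj_l2[of "conj_l2 f"] rep_conj_l2[of f] by eventually_elim simp
qed

lemma conj_l2_mult_l2:
  assumes "unimodular \<phi>"
  shows "conj_l2 (mult_l2 \<phi> f) = mult_l2 (\<lambda>z. cnj (\<phi> z)) (conj_l2 f)"
proof (rule l2_eqI)
  show "AE z in circle_measure. rep_l2 (conj_l2 (mult_l2 \<phi> f)) z =
      rep_l2 (mult_l2 (\<lambda>z. cnj (\<phi> z)) (conj_l2 f)) z"
    using rep_conj_l2[of "mult_l2 \<phi> f"] rep_mult_l2[OF assms, of f] rep_conj_l2[of f]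
      rep_mult_l2[OF unimodular_cnj[OF assms], of "conj_l2 f"]
    by eventually_elim simp
qed

lemma cinner_conj_l2: "cinner (conj_l2 f) (conj_l2 g) = cinner g f"
  unfolding cinner_eq[of g f]
proof (rule cinner_cong)
  show "AE z in circle_measure. rep_l2 (conj_l2 f) z * cnj (rep_l2 (conj_l2 g) z) =
      rep_l2 g z * cnj (rep_l2 f z)"
    using rep_conj_l2[of f] rep_conj_l2[of g] by eventually_elim simp
qed (use integrable_cinner in auto)

definition monomial :: "int \<Rightarrow> l2" where
  "monomial n = abs_l2 (\<lambda>z. z powi n)"

lemma rep_monomial: "AE z in circle_measure. rep_l2 (monomial n) z = z powi n"
  unfolding monomial_def by (rule rep_abs_l2[OF square_integrable_powi])

lemma powi_cnj: "cmod z = 1 \<Longrightarrow> cnj z powi n = z powi (- n)"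
  by (simp add: cnj_eq_inverse power_int_inverse power_int_minus)

lemma mult_monomial: "mult_l2 (\<lambda>z. z) (monomial n) = monomial (n + 1)"
proof (rule l2_eqI)
  show "AE z in circle_measure. rep_l2 (mult_l2 (\<lambda>z. z) (monomial n)) z = rep_l2 (monomial (n + 1)) z"
    using rep_mult_l2[OF unimodular_ident, of "monomial n"] rep_monomial[of n] rep_monomial[of "n + 1"]
      AE_circle_norm
  proof eventually_elim
    case (elim z)
    then have "z \<noteq> 0" by auto
    with elim show ?case by (simp add: power_int_add)
  qed
qed

lemma conj_monomial: "conj_l2 (monomial n) = monomial (- n)"
proof (rule l2_eqI)
  show "AE z in circle_measure. rep_l2 (conj_l2 (monomial n)) z = rep_l2 (monomial (- n)) z"
    using rep_conj_l2[of "monomial n"] rep_monomial[of n] rep_monomial[of "- n"] AE_circle_norm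
    by eventually_elim (simp add: powi_cnj)
qed

lemma cinner_monomial_eq_fourier: "cinner f (monomial n) = fourier (rep_l2 f) n"
  unfolding fourier_def
proof (rule cinner_cong)
  show "AE z in circle_measure. rep_l2 f z * cnj (rep_l2 (monomial n) z) = rep_l2 f z * z powi (- n)"
    using rep_monomial[of n] AE_circle_norm by eventually_elim (simp add: powi_cnj)
  show "(\<lambda>z. rep_l2 f z * z powi (- n)) \<in> borel_measurable circle_measure"
    by (intro borel_measurable_times measurable_rep_l2 borel_measurable_circle) measurable
qed

lemma cinner_monomials: "cinner (monomial m) (monomial n) = (if m = n then 1 else 0)"
proof -
  have "cinner (monomial m) (monomial n) = (\<integral>z. z powi (m - n) \<partial>circle_measure)"
  proof (rule cinner_cong)
    show "AE z in circle_measure. rep_l2 (monomial m) z * cnj (rep_l2 (monomial n) z) = z powi (m - n)"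
      using rep_monomial[of m] rep_monomial[of n] AE_circle_norm
    proof eventually_elim
      case (elim z)
      then have "z \<noteq> 0" by auto
      with elim show ?case using power_int_add[of z m "- n"] by (simp add: powi_cnj)
    qed
    show "(\<lambda>z. z powi (m - n)) \<in> borel_measurable circle_measure"
      by (rule borel_measurable_circle) measurable
  qed
  then show ?thesis by (simp add: integral_circle_powi)
qed

lemma monomials_complete:
  assumes "\<And>n. cinner f (monomial n) = 0" shows "f = 0"
proof -
  have "AE z in circle_measure. rep_l2 f z = 0"
    using assms by (intro fourier_unique square_integrable_imp_integrable)
      (auto simp: cinner_monomial_eq_fourier)
  then have "cinner f f = (\<integral>z. 0 \<partial>circle_measure)"
    by (intro cinner_cong) (auto elim: AE_mp)
  then show ?thesis by (intro cinner_definite) simp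
qed

section \<open>The Hardy space and model spaces in Fourier terms\<close>

lemma H2_orthogonal:
  assumes f: "f \<in> H2" and u: "\<And>n. n \<ge> 0 \<Longrightarrow> cinner u (monomial n) = 0"
  shows "cinner u f = 0"
proof -
  obtain F where "F \<in> hardy_disk" "AE z in circle_measure.
     ((\<lambda>r. F (of_real r * z)) \<longlongrightarrow> rep_l2 f z) (at_left (1::real))"
    using f unfolding H2_def by blast
  then show ?thesis
    unfolding cinner_eq using u
    by (intro hardy_orthogonal) (auto simp: cinner_monomial_eq_fourier)
qed

lemma H2_iff: "f \<in> H2 \<longleftrightarrow> (\<forall>n<0. cinner f (monomial n) = 0)"
proof
  assume f: "f \<in> H2"
  show "\<forall>n<0. cinner f (monomial n) = 0"
  proof (intro allI impI)
    fix n :: int assume "n < 0"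
    then have "cinner (monomial n) f = 0"
      by (intro H2_orthogonal[OF f]) (auto simp: cinner_monomials)
    then show "cinner f (monomial n) = 0" by (simp add: cinner_commute[of f])
  qed
next
  assume "\<forall>n<0. cinner f (monomial n) = 0"
  then show "f \<in> H2"
    using hardy_extension[OF square_integrable_rep[of f]]
    by (simp add: H2_def cinner_monomial_eq_fourier)
qed

definition has_radial_limit :: "(complex \<Rightarrow> complex) \<Rightarrow> complex \<Rightarrow> bool" where
  "has_radial_limit F z \<longleftrightarrow> (\<exists>l. ((\<lambda>r. F (of_real r * z)) \<longlongrightarrow> l) (at_left (1::real)))"

text \<open>The Cauchy criterion is stated with two natural-number parameters so that it describes a
  countable combination of sets.\<close>

lemma has_radial_limit_iff_Cauchy:
  "has_radial_limit F z \<longleftrightarrow>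
    (\<forall>m::nat. \<exists>n::nat. \<forall>r\<in>{1 - 1 / (real n + 2)<..<1}. \<forall>s\<in>{1 - 1 / (real n + 2)<..<1}.
       dist (F (of_real r * z)) (F (of_real s * z)) \<le> 1 / (real m + 1))" (is "_ \<longleftrightarrow> ?C")
proof
  assume "has_radial_limit F z"
  then obtain l where l: "((\<lambda>r. F (of_real r * z)) \<longlongrightarrow> l) (at_left (1::real))"
    by (auto simp: has_radial_limit_def)
  show ?C
  proof
    fix m :: nat
    have "0 < 1 / (2 * (real m + 1))" by simp
    from tendstoD[OF l this] have "\<exists>b<1. \<forall>r>b. r < 1 \<longrightarrow>
        dist (F (of_real r * z)) l < 1 / (2 * (real m + 1))"
      by (simp only: eventually_at_left_field)
    then obtain b where b: "b < 1"
      "\<And>r. b < r \<Longrightarrow> r < 1 \<Longrightarrow> dist (F (of_real r * z)) l < 1 / (2 * (real m + 1))"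
      by metis
    obtain n :: nat where n: "1 / (1 - b) < real n" using reals_Archimedean2 by blast
    then have "1 / (real n + 2) < 1 - b"
      using b(1) by (simp add: field_simps)
    then have nb: "b < 1 - 1 / (real n + 2)" by simp
    show "\<exists>n::nat. \<forall>r\<in>{1 - 1 / (real n + 2)<..<1}. \<forall>s\<in>{1 - 1 / (real n + 2)<..<1}.
       dist (F (of_real r * z)) (F (of_real s * z)) \<le> 1 / (real m + 1)"
    proof (intro exI ballI)
      fix r s assume "r \<in> {1 - 1 / (real n + 2)<..<1}" "s \<in> {1 - 1 / (real n + 2)<..<1}"
      then have "dist (F (of_real r * z)) l < 1 / (2 * (real m + 1))"
          "dist (F (of_real s * z)) l < 1 / (2 * (real m + 1))"
        using b(2) nb by auto
      then have "dist (F (of_real r * z)) (F (of_real s * z)) <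
          1 / (2 * (real m + 1)) + 1 / (2 * (real m + 1))"
        by (smt (verit) dist_triangle2)
      also have "\<dots> = 1 / (real m + 1)" by (simp add: field_simps)
      finally show "dist (F (of_real r * z)) (F (of_real s * z)) \<le> 1 / (real m + 1)" by simp
    qed
  qed
next
  assume C: ?C
  have Cau: "\<exists>b<1. \<forall>r s. b < r \<and> r < 1 \<and> b < s \<and> s < 1 \<longrightarrow>
      dist (F (of_real r * z)) (F (of_real s * z)) < e" if e: "e > 0" for e
  proof -
    obtain m :: nat where m: "inverse (real (Suc m)) < e" using reals_Archimedean[OF e] by blast
    obtain n :: nat where n: "\<forall>r\<in>{1 - 1 / (real n + 2)<..<1}. \<forall>s\<in>{1 - 1 / (real n + 2)<..<1}.
       dist (F (of_real r * z)) (F (of_real s * z)) \<le> 1 / (real m + 1)"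
      using C by blast
    have le: "1 / (real m + 1) < e" using m by (simp add: inverse_eq_divide add.commute)
    show ?thesis
      by (intro exI[of _ "1 - 1 / (real n + 2)"]) (use n in \<open>auto intro!: le_less_trans[OF _ le]\<close>)
  qed
  define \<rho> where "\<rho> k = 1 - 1 / (real k + 2)" for k
  have ev\<rho>: "\<forall>\<^sub>F k in sequentially. b < \<rho> k \<and> \<rho> k < 1" if "b < 1" for b
  proof -
    have "\<forall>\<^sub>F r in at_left (1::real). b < r \<and> r < 1"
      by (rule eventually_at_leftI[OF _ that]) simp
    then show ?thesis
      unfolding \<rho>_def using seq_to_one by (rule eventually_compose_filterlim)
  qed
  have "Cauchy (\<lambda>k. F (of_real (\<rho> k) * z))"
  proof (rule metric_CauchyI)
    fix e :: real assume "0 < e"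
    then obtain b where b: "b < 1" "\<forall>r s. b < r \<and> r < 1 \<and> b < s \<and> s < 1 \<longrightarrow>
      dist (F (of_real r * z)) (F (of_real s * z)) < e" using Cau by blast
    obtain K where "\<And>k. k \<ge> K \<Longrightarrow> b < \<rho> k \<and> \<rho> k < 1"
      using ev\<rho>[OF b(1)] unfolding eventually_sequentially by blast
    then show "\<exists>K. \<forall>m\<ge>K. \<forall>n\<ge>K. dist (F (of_real (\<rho> m) * z)) (F (of_real (\<rho> n) * z)) < e"
      using b(2) by blast
  qed
  then obtain l where l: "(\<lambda>k. F (of_real (\<rho> k) * z)) \<longlonglongrightarrow> l"
    using Cauchy_convergent_iff convergent_def by blast
  have "((\<lambda>r. F (of_real r * z)) \<longlongrightarrow> l) (at_left (1::real))"
  proof (rule tendstoI)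
    fix e :: real assume "0 < e"
    then obtain b where b: "b < 1" "\<forall>r s. b < r \<and> r < 1 \<and> b < s \<and> s < 1 \<longrightarrow>
      dist (F (of_real r * z)) (F (of_real s * z)) < e / 2" using Cau[of "e / 2"] by auto
    have "\<forall>\<^sub>F k in sequentially. b < \<rho> k \<and> \<rho> k < 1 \<and> dist (F (of_real (\<rho> k) * z)) l < e / 2"
      using ev\<rho>[OF b(1)] tendstoD[OF l, of "e / 2"] \<open>0 < e\<close> by (auto elim: eventually_elim2)
    then obtain k where k: "b < \<rho> k" "\<rho> k < 1" "dist (F (of_real (\<rho> k) * z)) l < e / 2"
      by (auto dest: eventually_happens)
    show "\<forall>\<^sub>F r in at_left (1::real). dist (F (of_real r * z)) l < e"
      unfolding eventually_at_left_field
    proof (intro exI conjI allI impI)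
      fix r assume "b < r" "r < 1"
      then have "dist (F (of_real r * z)) (F (of_real (\<rho> k) * z)) < e / 2" using b(2) k by blast
      then show "dist (F (of_real r * z)) l < e"
        using k(3) dist_triangle[of "F (of_real r * z)" l "F (of_real (\<rho> k) * z)"] by linarith
    qed (rule b(1))
  qed
  then show "has_radial_limit F z" by (auto simp: has_radial_limit_def)
qed

text \<open>For fixed radii the Cauchy condition is closed in the angle, so radial convergence is a
  Borel condition; where it fails, \<^const>\<open>boundary_fun\<close> takes a constant default value.\<close>

lemma measurable_boundary_fun:
  assumes F: "F holomorphic_on ball 0 1"
  shows "boundary_fun F \<in> borel_measurable circle_measure"
proof -
  define E where "E m n = {z\<in>sphere 0 1. \<forall>r\<in>{1 - 1 / (real n + 2)<..<1}. \<forall>s\<in>{1 - 1 / (real n + 2)<..<1}.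
       dist (F (of_real r * z)) (F (of_real s * z)) \<le> 1 / (real m + 1)}" for m n :: nat
  have cont: "continuous_on (sphere 0 1) (\<lambda>z. F (of_real r * z))" if "0 \<le> r" "r < 1" for r :: real
  proof (rule continuous_on_compose2[OF holomorphic_on_imp_continuous_on[OF F]])
    show "(\<lambda>w. complex_of_real r * w) ` sphere 0 1 \<subseteq> ball 0 1"
      using that by (auto simp: norm_mult)
  qed (intro continuous_intros)
  have closedE: "closed (E m n)" for m n
  proof -
    let ?I = "{1 - 1 / (real n + 2)<..<1}"
    have pos: "0 \<le> r" if "r \<in> ?I" for r
    proof -
      have "0 \<le> 1 - 1 / (real n + 2)" by simp
      moreover have "1 - 1 / (real n + 2) < r" using that by simp
      ultimately show ?thesis by linarith
    qed
    have "closed {z\<in>sphere 0 1. dist (F (of_real r * z)) (F (of_real s * z)) \<le> 1 / (real m + 1)}"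
      if "r \<in> ?I" "s \<in> ?I" for r s
      by (rule continuous_on_closed_Collect_le)
        (use that pos in \<open>auto intro!: continuous_intros cont\<close>)
    then have "closed (sphere 0 1 \<inter> (\<Inter>r\<in>?I. \<Inter>s\<in>?I.
        {z\<in>sphere 0 1. dist (F (of_real r * z)) (F (of_real s * z)) \<le> 1 / (real m + 1)}))"
      by (intro closed_Int closed_INT ballI) auto
    also have "(sphere 0 1 \<inter> (\<Inter>r\<in>?I. \<Inter>s\<in>?I.
        {z\<in>sphere 0 1. dist (F (of_real r * z)) (F (of_real s * z)) \<le> 1 / (real m + 1)})) = E m n"
      unfolding E_def by blast
    finally show ?thesis .
  qed
  have "E m n \<in> sets circle_measure" for m n
  proof -
    have "E m n \<subseteq> sphere 0 1" by (auto simp: E_def)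
    then show ?thesis
      using borel_closed[OF closedE] unfolding sets_circle by (simp add: sets_restrict_space_iff)
  qed
  then have D: "(\<Inter>m. \<Union>n. E m n) \<in> sets circle_measure" by auto
  have Deq: "z \<in> (\<Inter>m. \<Union>n. E m n) \<longleftrightarrow> has_radial_limit F z" if "z \<in> space circle_measure" for z
    using that unfolding has_radial_limit_iff_Cauchy E_def by (simp add: space_circle)
  define \<rho> where "\<rho> k = 1 - 1 / (real k + 2)" for k
  have \<rho>: "0 \<le> \<rho> k" "\<rho> k < 1" for k by (auto simp: \<rho>_def field_simps)
  \<comment> \<open>The value of \<^const>\<open>Lim\<close> where no limit exists.\<close>
  define c0 where "c0 = (THE l :: complex. False)"
  have eq: "boundary_fun F z =
      (if z \<in> (\<Inter>m. \<Union>n. E m n) then lim (\<lambda>k. F (of_real (\<rho> k) * z)) else c0)"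
    if z: "z \<in> space circle_measure" for z
  proof (cases "has_radial_limit F z")
    case True
    then obtain l where l: "((\<lambda>r. F (of_real r * z)) \<longlongrightarrow> l) (at_left (1::real))"
      by (auto simp: has_radial_limit_def)
    have "(\<lambda>k. F (of_real (\<rho> k) * z)) \<longlonglongrightarrow> l"
      using filterlim_compose[OF l seq_to_one] by (simp add: \<rho>_def)
    then have "lim (\<lambda>k. F (of_real (\<rho> k) * z)) = l" by (rule limI)
    moreover have "boundary_fun F z = l"
      unfolding boundary_fun_def by (rule tendsto_Lim[OF _ l]) simp
    ultimately show ?thesis using True Deq[OF z] by simp
  next
    case False
    then have "boundary_fun F z = c0"
      by (simp add: boundary_fun_def Topological_Spaces.Lim_def c0_def has_radial_limit_def)
    then show ?thesis using False unfolding Deq[OF z] by simp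
  qed
  have "(\<lambda>z. lim (\<lambda>k. F (of_real (\<rho> k) * z))) \<in> borel_measurable circle_measure"
    by (rule borel_measurable_lim_metric) (rule measurable_dilation(1)[OF F \<rho>])
  then have "(\<lambda>z. if z \<in> (\<Inter>m. \<Union>n. E m n) then lim (\<lambda>k. F (of_real (\<rho> k) * z)) else c0)
      \<in> borel_measurable circle_measure"
    using D sets.sets_into_space[OF D] by (intro measurable_If_set) (auto simp: Int_absorb2)
  then show ?thesis
    by (subst measurable_cong[OF eq]) auto
qed

lemma inner_radial_limit:
  assumes "inner_function \<theta>"
  shows "AE z in circle_measure. cmod (boundary_fun \<theta> z) = 1 \<and>
    ((\<lambda>r. \<theta> (of_real r * z)) \<longlongrightarrow> boundary_fun \<theta> z) (at_left (1::real))"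
proof -
  have "AE z in circle_measure.
      \<exists>w. cmod w = 1 \<and> ((\<lambda>r. \<theta> (of_real r * z)) \<longlongrightarrow> w) (at_left (1::real))"
    using assms unfolding inner_function_def by blast
  then show ?thesis
  proof eventually_elim
    case (elim z)
    then obtain w where w: "cmod w = 1" "((\<lambda>r. \<theta> (of_real r * z)) \<longlongrightarrow> w) (at_left (1::real))"
      by blast
    have "boundary_fun \<theta> z = w"
      unfolding boundary_fun_def by (rule tendsto_Lim[OF _ w(2)]) simp
    with w show ?case by simp
  qed
qed

lemma unimodular_boundary_fun:
  assumes "inner_function \<theta>" shows "unimodular (boundary_fun \<theta>)"
proof -
  have "boundary_fun \<theta> \<in> borel_measurable circle_measure"
    using assms unfolding inner_function_def by (blast intro: measurable_boundary_fun)
  moreover have "AE z in circle_measure. cmod (boundary_fun \<theta> z) = 1"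
    using inner_radial_limit[OF assms] by eventually_elim blast
  ultimately show ?thesis by (simp add: unimodular_def)
qed

text \<open>On the disk the product with \<open>\<theta>\<close> stays holomorphic with bounded means, because \<open>\<theta>\<close> is bounded,
  and radial limits multiply.\<close>

lemma H2_mult_inner:
  assumes inner: "inner_function \<theta>" and f: "f \<in> H2"
  shows "mult_l2 (boundary_fun \<theta>) f \<in> H2"
proof -
  have hol: "\<theta> holomorphic_on ball 0 1" using inner by (simp add: inner_function_def)
  obtain K where "\<forall>w\<in>\<theta> ` ball 0 1. cmod w \<le> K"
    using inner unfolding inner_function_def bounded_iff by blast
  then have K: "cmod (\<theta> z) \<le> K" if "cmod z < 1" for z
    using that by simp
  obtain F where F: "F \<in> hardy_disk" and lim: "AE z in circle_measure.
     ((\<lambda>r. F (of_real r * z)) \<longlongrightarrow> rep_l2 f z) (at_left (1::real))"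
    using f unfolding H2_def by blast
  have Fhol: "F holomorphic_on ball 0 1" using F by (simp add: hardy_disk_def)
  obtain B where B: "\<forall>r\<in>{0..<1}. (\<integral>z. (cmod (F (of_real r * z)))\<^sup>2 \<partial>circle_measure) \<le> B"
    using F unfolding hardy_disk_def by blast
  have prodhol: "(\<lambda>z. \<theta> z * F z) holomorphic_on ball 0 1"
    using hol Fhol by (rule holomorphic_on_mult)
  have "(\<integral>z. (cmod (\<theta> (of_real r * z) * F (of_real r * z)))\<^sup>2 \<partial>circle_measure) \<le> K\<^sup>2 * B"
    if r: "r \<in> {0..<1}" for r :: real
  proof -
    have Fi: "integrable circle_measure (\<lambda>z. (cmod (F (of_real r * z)))\<^sup>2)"
      using square_integrable_dilation[OF Fhol, of r] r by (simp add: square_integrable_def)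
    have "(\<integral>z. (cmod (\<theta> (of_real r * z) * F (of_real r * z)))\<^sup>2 \<partial>circle_measure)
        \<le> (\<integral>z. K\<^sup>2 * (cmod (F (of_real r * z)))\<^sup>2 \<partial>circle_measure)"
    proof (rule integral_mono)
      show "integrable circle_measure (\<lambda>z. (cmod (\<theta> (of_real r * z) * F (of_real r * z)))\<^sup>2)"
        using square_integrable_dilation[OF prodhol, of r] r by (simp add: square_integrable_def)
      fix z assume "z \<in> space circle_measure"
      then have "cmod (of_real r * z) < 1" using r by (simp add: space_circle norm_mult)
      then have "(cmod (\<theta> (of_real r * z)))\<^sup>2 \<le> K\<^sup>2" using K by (intro power_mono) auto
      then show "(cmod (\<theta> (of_real r * z) * F (of_real r * z)))\<^sup>2 \<le> K\<^sup>2 * (cmod (F (of_real r * z)))\<^sup>2"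
        unfolding norm_mult power_mult_distrib by (rule mult_right_mono) simp
    qed (use Fi in simp)
    also have "\<dots> = K\<^sup>2 * (\<integral>z. (cmod (F (of_real r * z)))\<^sup>2 \<partial>circle_measure)" by simp
    also have "\<dots> \<le> K\<^sup>2 * B" using B r by (intro mult_left_mono) auto
    finally show ?thesis .
  qed
  with prodhol have "(\<lambda>z. \<theta> z * F z) \<in> hardy_disk" unfolding hardy_disk_def by blast
  moreover have "AE z in circle_measure. ((\<lambda>r. \<theta> (of_real r * z) * F (of_real r * z)) \<longlongrightarrow>
      rep_l2 (mult_l2 (boundary_fun \<theta>) f) z) (at_left (1::real))"
    using lim inner_radial_limit[OF inner] rep_mult_l2[OF unimodular_boundary_fun[OF inner], of f]
  proof eventually_elim
    case (elim z)
    then show ?case unfolding elim(3) by (intro tendsto_mult) auto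
  qed
  ultimately show ?thesis unfolding H2_def mem_Collect_eq
    by (rule bexI[where x = "\<lambda>z. \<theta> z * F z", rotated])
qed

definition inner_monomial :: "(complex \<Rightarrow> complex) \<Rightarrow> int \<Rightarrow> l2" where
  "inner_monomial \<theta> n = mult_l2 (boundary_fun \<theta>) (monomial n)"

lemma cinner_inner_monomials:
  assumes "inner_function \<theta>"
  shows "cinner (inner_monomial \<theta> m) (inner_monomial \<theta> n) = (if m = n then 1 else 0)"
  by (simp add: inner_monomial_def cinner_mult_l2[OF unimodular_boundary_fun[OF assms]] cinner_monomials)

lemma mult_inner_monomial:
  assumes "inner_function \<theta>"
  shows "mult_l2 (\<lambda>z. z) (inner_monomial \<theta> n) = inner_monomial \<theta> (n + 1)"
proof -
  note b = unimodular_boundary_fun[OF assms]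
  have "mult_l2 (\<lambda>z. z) (inner_monomial \<theta> n) = mult_l2 (boundary_fun \<theta>) (mult_l2 (\<lambda>z. z) (monomial n))"
    unfolding inner_monomial_def mult_l2_mult[OF b unimodular_ident] mult_l2_mult[OF unimodular_ident b]
    by (simp add: mult.commute)
  then show ?thesis by (simp add: mult_monomial inner_monomial_def)
qed

text \<open>The inner product depends only on the difference of the indices, since multiplication by
  \<open>z\<close> is unitary; so one may assume \<open>m < 0 \<le> n\<close>, where the left-hand vector lies in the Hardy
  space.\<close>

lemma cinner_inner_monomial_monomial:
  assumes "inner_function \<theta>" "m < n"
  shows "cinner (inner_monomial \<theta> n) (monomial m) = 0"
proof -
  have shift: "cinner (inner_monomial \<theta> (j + int k)) (monomial (i + int k)) =
      cinner (inner_monomial \<theta> j) (monomial i)" for i j k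
  proof (induction k)
    case (Suc k)
    then show ?case
      using cinner_mult_l2[OF unimodular_ident, of "inner_monomial \<theta> (j + int k)" "monomial (i + int k)"]
      by (simp add: mult_inner_monomial[OF assms(1)] mult_monomial ac_simps)
  qed simp
  have pos: "cinner (inner_monomial \<theta> j) (monomial i) = 0" if "0 \<le> j" "i < 0" for i j
  proof -
    have "monomial j \<in> H2" using that by (simp add: H2_iff cinner_monomials)
    then have "inner_monomial \<theta> j \<in> H2"
      unfolding inner_monomial_def by (rule H2_mult_inner[OF assms(1)])
    then show ?thesis using that by (simp add: H2_iff)
  qed
  show ?thesis
  proof (cases "0 \<le> n")
    case True
    show ?thesis
    proof (cases "m < 0")
      case False
      then show ?thesis
        using shift[of "n - m - 1" "nat (m + 1)" "-1"] pos[of "n - m - 1" "-1"] assms(2) by simp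
    qed (use True pos in simp)
  next
    case False
    then show ?thesis
      using shift[of n "nat (- n)" m] pos[of 0 "m - n"] assms(2) by simp
  qed
qed

text \<open>Multiplication by the conjugate boundary function moves the second condition into the Hardy
  space, so orthogonality to its image only has to be tested on monomials.\<close>

lemma model_space_iff:
  assumes inner: "inner_function \<theta>"
  shows "f \<in> model_space \<theta> \<longleftrightarrow>
    (\<forall>n<0. cinner f (monomial n) = 0) \<and> (\<forall>n\<ge>0. cinner f (inner_monomial \<theta> n) = 0)"
proof
  assume f: "f \<in> model_space \<theta>"
  have "cinner f (inner_monomial \<theta> n) = 0" if "n \<ge> 0" for n
  proof -
    have "monomial n \<in> H2" using that by (simp add: H2_iff cinner_monomials)
    then show ?thesis using f by (simp add: model_space_def inner_monomial_def)
  qed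
  with f show "(\<forall>n<0. cinner f (monomial n) = 0) \<and> (\<forall>n\<ge>0. cinner f (inner_monomial \<theta> n) = 0)"
    by (simp add: model_space_def H2_iff)
next
  assume f: "(\<forall>n<0. cinner f (monomial n) = 0) \<and> (\<forall>n\<ge>0. cinner f (inner_monomial \<theta> n) = 0)"
  note b = unimodular_boundary_fun[OF inner]
  have "cinner f (mult_l2 (boundary_fun \<theta>) h) = 0" if "h \<in> H2" for h
    unfolding cinner_mult_l2_right[OF b]
  proof (rule H2_orthogonal[OF that])
    fix n :: int assume "n \<ge> 0"
    then show "cinner (mult_l2 (\<lambda>z. cnj (boundary_fun \<theta> z)) f) (monomial n) = 0"
      using f by (simp add: inner_monomial_def flip: cinner_mult_l2_right[OF b])
  qed
  with f show "f \<in> model_space \<theta>"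
    by (auto simp: model_space_def H2_iff)
qed

lemma model_space_add:
  "inner_function \<theta> \<Longrightarrow> f \<in> model_space \<theta> \<Longrightarrow> g \<in> model_space \<theta> \<Longrightarrow> f + g \<in> model_space \<theta>"
  by (simp add: model_space_iff cinner_add_left)

lemma model_space_scaleC:
  "inner_function \<theta> \<Longrightarrow> f \<in> model_space \<theta> \<Longrightarrow> c *\<^sub>C f \<in> model_space \<theta>"
  by (simp add: model_space_iff cinner_scaleC_left)

lemma model_space_diff:
  "inner_function \<theta> \<Longrightarrow> f \<in> model_space \<theta> \<Longrightarrow> g \<in> model_space \<theta> \<Longrightarrow> f - g \<in> model_space \<theta>"
  by (simp add: model_space_iff cinner_diff_left)

section \<open>The compressed shift, its adjoint and the model conjugation\<close>

lemma orth_proj_eqI: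
  assumes diff: "\<And>f g. f \<in> H \<Longrightarrow> g \<in> H \<Longrightarrow> f - g \<in> H"
    and g: "g \<in> H" "\<And>h. h \<in> H \<Longrightarrow> cinner (f - g) h = 0"
  shows "orth_proj H f = g"
  unfolding orth_proj_def
proof (rule the_equality)
  fix g' assume g': "g' \<in> H \<and> (\<forall>h\<in>H. cinner (f - g') h = 0)"
  have d: "g' - g \<in> H" using g' g diff by blast
  have "cinner (g' - g) (g' - g) = cinner (f - g) (g' - g) - cinner (f - g') (g' - g)"
    by (simp add: cinner_diff_left)
  also have "\<dots> = 0" using g g' d by simp
  finally show "g' = g" using cinner_definite by force
qed (use g in blast)

lemma adjoint_on_eqI:
  assumes diff: "\<And>f g. f \<in> H \<Longrightarrow> g \<in> H \<Longrightarrow> f - g \<in> H"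
    and h: "h \<in> H" "\<And>f. f \<in> H \<Longrightarrow> cinner (T f) g = cinner f h"
  shows "adjoint_on H T g = h"
  unfolding adjoint_on_def
proof (rule the_equality)
  fix h' assume h': "h' \<in> H \<and> (\<forall>f\<in>H. cinner (T f) g = cinner f h')"
  have d: "h' - h \<in> H" using h' h diff by blast
  have "cinner (h' - h) (h' - h) = cinner (h' - h) h' - cinner (h' - h) h"
    by (simp add: cinner_diff_right)
  also have "\<dots> = 0" using h h' d by force
  finally show "h' = h" using cinner_definite by force
qed (use h in blast)

text \<open>In terms of functions on the disk this is \<open>(f(z) - f(0)) / z\<close>.\<close>

definition backward_shift :: "l2 \<Rightarrow> l2" where
  "backward_shift f = mult_l2 (\<lambda>z. cnj z) (f - cinner f (monomial 0) *\<^sub>C monomial 0)"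

lemma backward_shift_scaleC: "backward_shift (c *\<^sub>C f) = c *\<^sub>C backward_shift f"
  by (simp add: backward_shift_def cinner_scaleC_left scaleC_diff_right
      mult_l2_scaleC[OF unimodular_cnj[OF unimodular_ident], symmetric] flip: scaleC_scaleC)

lemma cinner_backward_shift:
  "cinner (backward_shift f) g =
    cinner (f - cinner f (monomial 0) *\<^sub>C monomial 0) (mult_l2 (\<lambda>z. z) g)"
  unfolding backward_shift_def cinner_mult_l2_right[OF unimodular_ident] ..

lemma backward_shift_coeff:
  "cinner (backward_shift f) (monomial n) = (if n = -1 then 0 else cinner f (monomial (n + 1)))"
  by (auto simp: cinner_backward_shift mult_monomial cinner_diff_left cinner_scaleC_left cinner_monomials)

lemma mult_backward_shift:
  "mult_l2 (\<lambda>z. z) (backward_shift f) = f - cinner f (monomial 0) *\<^sub>C monomial 0"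
  unfolding backward_shift_def by (rule mult_l2_cancel(1)[OF unimodular_ident])

lemma cinner_shift_monomial:
  "cinner (mult_l2 (\<lambda>z. z) f) (monomial n) = cinner f (monomial (n - 1))"
  using cinner_mult_l2[OF unimodular_ident, of f "monomial (n - 1)"] by (simp add: mult_monomial)

lemma model_conj_eq:
  assumes "inner_function \<theta>"
  shows "model_conj \<theta> f = mult_l2 (\<lambda>z. boundary_fun \<theta> z * cnj z) (conj_l2 f)"
proof -
  note u = unimodular_mult[OF unimodular_boundary_fun[OF assms] unimodular_cnj[OF unimodular_ident]]
  show ?thesis
    unfolding model_conj_def mult_l2_def
  proof (rule abs_l2_eqI, unfold l2_rel_def, intro conjI)
    show "square_integrable (\<lambda>z. boundary_fun \<theta> z * cnj z * cnj (rep_l2 f z))"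
      by (intro square_integrable_unimodular_mult u square_integrable_cnj square_integrable_rep)
    show "square_integrable (\<lambda>z. boundary_fun \<theta> z * cnj z * rep_l2 (conj_l2 f) z)"
      by (intro square_integrable_unimodular_mult u square_integrable_rep)
    show "AE z in circle_measure. boundary_fun \<theta> z * cnj z * cnj (rep_l2 f z) =
        boundary_fun \<theta> z * cnj z * rep_l2 (conj_l2 f) z"
      using rep_conj_l2[of f] by eventually_elim simp
  qed
qed

context
  fixes \<theta> :: "complex \<Rightarrow> complex"
  assumes inner: "inner_function \<theta>"
begin

lemma unimodular_conj_symbol: "unimodular (\<lambda>z. boundary_fun \<theta> z * cnj z)"
  by (rule unimodular_mult[OF unimodular_boundary_fun[OF inner] unimodular_cnj[OF unimodular_ident]])

lemma model_conj_add: "model_conj \<theta> (f + g) = model_conj \<theta> f + model_conj \<theta> g"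
  by (simp add: model_conj_eq[OF inner] conj_l2_add mult_l2_add[OF unimodular_conj_symbol])

lemma model_conj_scaleC: "model_conj \<theta> (c *\<^sub>C f) = cnj c *\<^sub>C model_conj \<theta> f"
  by (simp add: model_conj_eq[OF inner] conj_l2_scaleC mult_l2_scaleC[OF unimodular_conj_symbol])

lemma model_conj_diff: "model_conj \<theta> (f - g) = model_conj \<theta> f - model_conj \<theta> g"
  using model_conj_add[of f "- g"] model_conj_scaleC[of "-1" g] by (simp flip: uminus_l2_eq_scaleC)

lemma cinner_model_conj: "cinner (model_conj \<theta> f) (model_conj \<theta> g) = cinner g f"
  by (simp add: model_conj_eq[OF inner] cinner_mult_l2[OF unimodular_conj_symbol] cinner_conj_l2)

lemma model_conj_involutive: "model_conj \<theta> (model_conj \<theta> f) = f"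
  unfolding model_conj_eq[OF inner] conj_l2_mult_l2[OF unimodular_conj_symbol] conj_l2_conj_l2
  by (rule mult_l2_cancel(1)[OF unimodular_conj_symbol])

lemma model_conj_shift:
  "model_conj \<theta> (mult_l2 (\<lambda>z. z) f) = mult_l2 (\<lambda>z. cnj z) (model_conj \<theta> f)"
  unfolding model_conj_eq[OF inner] conj_l2_mult_l2[OF unimodular_ident]
    mult_l2_mult[OF unimodular_conj_symbol unimodular_cnj[OF unimodular_ident]]
    mult_l2_mult[OF unimodular_cnj[OF unimodular_ident] unimodular_conj_symbol]
  by (simp add: mult.commute mult.left_commute)

lemma cnj_mult_monomial: "mult_l2 (\<lambda>z. cnj z) (monomial n) = monomial (n - 1)"
  using mult_l2_cancel(2)[OF unimodular_ident, of "monomial (n - 1)"] by (simp add: mult_monomial)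

text \<open>The model conjugation exchanges the two families of test vectors that cut out the model
  space, the negative monomials and the multiples of the inner function by nonnegative ones.\<close>

lemma model_conj_monomial: "model_conj \<theta> (monomial n) = inner_monomial \<theta> (- n - 1)"
  unfolding model_conj_eq[OF inner] conj_monomial inner_monomial_def cnj_mult_monomial[symmetric]
  by (simp add: mult_l2_mult[OF unimodular_boundary_fun[OF inner] unimodular_cnj[OF unimodular_ident]])

lemma model_conj_inner_monomial: "model_conj \<theta> (inner_monomial \<theta> n) = monomial (- n - 1)"
  using model_conj_involutive[of "monomial (- n - 1)"] by (simp add: model_conj_monomial)

lemma model_conj_in_model_space:
  assumes f: "f \<in> model_space \<theta>" shows "model_conj \<theta> f \<in> model_space \<theta>"
proof -
  have "cinner (model_conj \<theta> f) (monomial n) = 0" if "n < 0" for n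
    using cinner_model_conj[of f "inner_monomial \<theta> (- n - 1)"] f that
      cinner_commute[of "inner_monomial \<theta> (- n - 1)" f]
    by (simp add: model_conj_inner_monomial model_space_iff[OF inner])
  moreover have "cinner (model_conj \<theta> f) (inner_monomial \<theta> n) = 0" if "n \<ge> 0" for n
    using cinner_model_conj[of f "monomial (- n - 1)"] f that
      cinner_commute[of "monomial (- n - 1)" f]
    by (simp add: model_conj_monomial model_space_iff[OF inner])
  ultimately show ?thesis by (simp add: model_space_iff[OF inner])
qed

lemma cinner_shift_inner_monomial:
  "cinner (mult_l2 (\<lambda>z. z) f) (inner_monomial \<theta> n) = cinner f (inner_monomial \<theta> (n - 1))"
  using cinner_mult_l2[OF unimodular_ident, of f "inner_monomial \<theta> (n - 1)"]
  by (simp add: mult_inner_monomial[OF inner])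

text \<open>For \<open>f\<close> in the model space, \<open>z f\<close> is already orthogonal to the negative monomials and to
  \<open>\<theta> z\<^sup>n\<close> for \<open>n > 0\<close>; only the component along \<open>\<theta>\<close> itself has to be removed.\<close>

lemma compressed_shift_eq:
  assumes f: "f \<in> model_space \<theta>"
  shows "compressed_shift \<theta> f = mult_l2 (\<lambda>z. z) f -
      cinner (mult_l2 (\<lambda>z. z) f) (inner_monomial \<theta> 0) *\<^sub>C inner_monomial \<theta> 0" (is "_ = ?g")
    and "compressed_shift \<theta> f \<in> model_space \<theta>"
proof -
  have g: "?g \<in> model_space \<theta>"
    using f cinner_inner_monomial_monomial[OF inner]
    by (auto simp: model_space_iff[OF inner] cinner_diff_left cinner_scaleC_left
        cinner_inner_monomials[OF inner] cinner_shift_monomial cinner_shift_inner_monomial)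
  show eq: "compressed_shift \<theta> f = ?g"
    unfolding compressed_shift_def
  proof (rule orth_proj_eqI[OF model_space_diff[OF inner] g])
    fix h assume "h \<in> model_space \<theta>"
    then have "cinner (inner_monomial \<theta> 0) h = 0"
      using cinner_commute[of "inner_monomial \<theta> 0" h] by (simp add: model_space_iff[OF inner])
    then show "cinner (mult_l2 (\<lambda>z. z) f - ?g) h = 0"
      by (simp add: cinner_scaleC_left)
  qed
  show "compressed_shift \<theta> f \<in> model_space \<theta>" unfolding eq by (rule g)
qed

lemma compressed_shift_scaleC:
  assumes f: "f \<in> model_space \<theta>"
  shows "compressed_shift \<theta> (c *\<^sub>C f) = c *\<^sub>C compressed_shift \<theta> f"
  by (simp add: compressed_shift_eq(1)[OF f] compressed_shift_eq(1)[OF model_space_scaleC[OF inner f]]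
      mult_l2_scaleC[OF unimodular_ident] cinner_scaleC_left scaleC_diff_right flip: scaleC_scaleC)

lemma compressed_shift_adj_eq:
  assumes f: "f \<in> model_space \<theta>"
  shows "compressed_shift_adj \<theta> f = backward_shift f" and "backward_shift f \<in> model_space \<theta>"
proof -
  have "cinner (backward_shift f) (inner_monomial \<theta> n) = 0" if "n \<ge> 0" for n
  proof -
    have "cinner (monomial 0) (inner_monomial \<theta> (n + 1)) = 0"
      using cinner_commute[of "monomial 0" "inner_monomial \<theta> (n + 1)"]
        cinner_inner_monomial_monomial[OF inner, of 0 "n + 1"] that by simp
    then show ?thesis
      using f that by (simp add: cinner_backward_shift mult_inner_monomial[OF inner]
        cinner_diff_left cinner_scaleC_left model_space_iff[OF inner])
  qed
  then show b: "backward_shift f \<in> model_space \<theta>"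
    using f by (auto simp: model_space_iff[OF inner] backward_shift_coeff)
  show "compressed_shift_adj \<theta> f = backward_shift f"
    unfolding compressed_shift_adj_def
  proof (rule adjoint_on_eqI[OF model_space_diff[OF inner] b])
    fix g assume g: "g \<in> model_space \<theta>"
    have "cinner (inner_monomial \<theta> 0) f = 0"
      using f cinner_commute[of "inner_monomial \<theta> 0" f] by (simp add: model_space_iff[OF inner])
    then have "cinner (compressed_shift \<theta> g) f = cinner (mult_l2 (\<lambda>z. z) g) f"
      by (simp add: compressed_shift_eq(1)[OF g] cinner_diff_left cinner_scaleC_left)
    also have "\<dots> = cinner (mult_l2 (\<lambda>z. z) g) (f - cinner f (monomial 0) *\<^sub>C monomial 0)"
      using g by (simp add: cinner_diff_right cinner_scaleC_right cinner_shift_monomial model_space_iff[OF inner])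
    also have "\<dots> = cinner g (backward_shift f)"
      unfolding mult_backward_shift[symmetric] by (rule cinner_mult_l2[OF unimodular_ident])
    finally show "cinner (compressed_shift \<theta> g) f = cinner g (backward_shift f)" .
  qed
qed

text \<open>The conjugation turns multiplication by \<open>z\<close> into multiplication by its inverse and \<open>\<theta>\<close>
  into the function \<open>1 / z\<close>. So the correction term of the compressed shift becomes that of the
  backward shift.\<close>

lemma backward_shift_model_conj:
  assumes f: "f \<in> model_space \<theta>"
  shows "backward_shift (model_conj \<theta> f) = model_conj \<theta> (compressed_shift \<theta> f)"
proof -
  have "cinner (model_conj \<theta> f) (monomial 0) = cinner (inner_monomial \<theta> (- 1)) f"
    using cinner_model_conj[of f "inner_monomial \<theta> (- 1)"] by (simp add: model_conj_inner_monomial)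
  also have "\<dots> = cnj (cinner (mult_l2 (\<lambda>z. z) f) (inner_monomial \<theta> 0))"
    using cinner_commute[of "inner_monomial \<theta> (- 1)" f] by (simp add: cinner_shift_inner_monomial)
  finally show ?thesis
    by (simp add: compressed_shift_eq(1)[OF f] backward_shift_def model_conj_diff model_conj_scaleC
        model_conj_shift model_conj_inner_monomial mult_l2_diff[OF unimodular_cnj[OF unimodular_ident]]
        mult_l2_scaleC[OF unimodular_cnj[OF unimodular_ident]] cnj_mult_monomial)
qed

lemma compressed_shift_model_conj:
  assumes f: "f \<in> model_space \<theta>"
  shows "compressed_shift \<theta> (model_conj \<theta> f) = model_conj \<theta> (backward_shift f)"
  using backward_shift_model_conj[OF model_conj_in_model_space[OF f]]
  by (simp add: model_conj_involutive)

text \<open>The function \<open>1 - cnj (\<theta> 0) * \<theta>\<close>, which represents evaluation at the origin on the model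
  space.\<close>

definition reproducing_kernel :: l2 where
  "reproducing_kernel = monomial 0 - cinner (monomial 0) (inner_monomial \<theta> 0) *\<^sub>C inner_monomial \<theta> 0"

lemma reproducing_kernel_in_model_space: "reproducing_kernel \<in> model_space \<theta>"
proof -
  have "cinner (monomial 0) (inner_monomial \<theta> n) = 0" if "n > 0" for n
    using cinner_commute[of "monomial 0" "inner_monomial \<theta> n"]
      cinner_inner_monomial_monomial[OF inner, of 0 n] that by simp
  then show ?thesis
    using cinner_inner_monomial_monomial[OF inner]
    by (auto simp: model_space_iff[OF inner] reproducing_kernel_def cinner_diff_left cinner_scaleC_left
        cinner_monomials cinner_inner_monomials[OF inner])
qed

lemma cinner_reproducing_kernel:
  "f \<in> model_space \<theta> \<Longrightarrow> cinner f reproducing_kernel = cinner f (monomial 0)"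
  by (simp add: reproducing_kernel_def cinner_diff_right cinner_scaleC_right model_space_iff[OF inner])

text \<open>The defect of the adjoint has rank at most one. Multiplying the backward shift of \<open>f\<close> by
  \<open>z\<close> gives \<open>f - f(0)\<close>, and the constant \<open>f(0)\<close> is all that contributes to the component along
  \<open>\<theta>\<close> that the compression removes.\<close>

lemma shift_backward_shift:
  assumes f: "f \<in> model_space \<theta>"
  shows "compressed_shift \<theta> (backward_shift f) = f - cinner f (monomial 0) *\<^sub>C reproducing_kernel"
proof -
  let ?c = "cinner f (monomial 0)" and ?d = "cinner (monomial 0) (inner_monomial \<theta> 0)"
  have "cinner (f - ?c *\<^sub>C monomial 0) (inner_monomial \<theta> 0) = (-1) * (?c * ?d)"
    using f by (simp add: cinner_diff_left cinner_scaleC_left model_space_iff[OF inner])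
  then have "compressed_shift \<theta> (backward_shift f) =
      f - ?c *\<^sub>C monomial 0 + ?c *\<^sub>C ?d *\<^sub>C inner_monomial \<theta> 0"
    unfolding compressed_shift_eq(1)[OF compressed_shift_adj_eq(2)[OF f]] mult_backward_shift
    by (simp only: scaleC_scaleC[symmetric] uminus_l2_eq_scaleC[symmetric] diff_minus_eq_add)
  also have "\<dots> = f - ?c *\<^sub>C reproducing_kernel"
    by (simp add: reproducing_kernel_def scaleC_diff_right)
  finally show ?thesis .
qed

text \<open>The compressed shift is irreducible. An operator commuting with it and its adjoint commutes
  with the rank-one defect operator, hence scales the zeroth Fourier coefficient by a constant;
  the backward shift carries the same constant to every coefficient.\<close>

lemma commutant_scalar:
  assumes U: "\<And>f. f \<in> model_space \<theta> \<Longrightarrow> U f \<in> model_space \<theta>"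
    and add: "\<And>f g. f \<in> model_space \<theta> \<Longrightarrow> g \<in> model_space \<theta> \<Longrightarrow> U (f + g) = U f + U g"
    and scale: "\<And>c f. f \<in> model_space \<theta> \<Longrightarrow> U (c *\<^sub>C f) = c *\<^sub>C U f"
    and S: "\<And>f. f \<in> model_space \<theta> \<Longrightarrow> U (compressed_shift \<theta> f) = compressed_shift \<theta> (U f)"
    and B: "\<And>f. f \<in> model_space \<theta> \<Longrightarrow> U (backward_shift f) = backward_shift (U f)"
  shows "\<exists>c. \<forall>f\<in>model_space \<theta>. U f = c *\<^sub>C f"
proof -
  let ?k = reproducing_kernel
  note k = reproducing_kernel_in_model_space
  have rank_one: "cinner (U f) (monomial 0) * cinner ?k (monomial 0) =
      cinner f (monomial 0) * cinner (U ?k) (monomial 0)" if f: "f \<in> model_space \<theta>" for f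
  proof -
    note bf = compressed_shift_adj_eq(2)[OF f]
    have "U f - cinner (U f) (monomial 0) *\<^sub>C ?k = compressed_shift \<theta> (backward_shift (U f))"
      by (rule shift_backward_shift[OF U[OF f], symmetric])
    also have "\<dots> = U (compressed_shift \<theta> (backward_shift f))"
      by (simp add: S[OF bf] B[OF f])
    also have "\<dots> = U (f + (- cinner f (monomial 0)) *\<^sub>C ?k)"
      unfolding shift_backward_shift[OF f]
      by (simp add: uminus_l2_eq_scaleC scaleC_scaleC diff_conv_add_uminus del: add_uminus_conv_diff)
    also have "\<dots> = U f + (- cinner f (monomial 0)) *\<^sub>C U ?k"
      by (simp add: add[OF f model_space_scaleC[OF inner k]] scale[OF k])
    finally have "cinner (U f - cinner (U f) (monomial 0) *\<^sub>C ?k) (monomial 0) =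
        cinner (U f + (- cinner f (monomial 0)) *\<^sub>C U ?k) (monomial 0)"
      by (rule arg_cong[where f = "\<lambda>x. cinner x (monomial 0)"])
    then show ?thesis by (simp add: cinner_diff_left cinner_add_left cinner_scaleC_left)
  qed
  obtain c where c: "\<And>f. f \<in> model_space \<theta> \<Longrightarrow> cinner (U f) (monomial 0) = c * cinner f (monomial 0)"
  proof (cases "cinner ?k (monomial 0) = 0")
    case True
    \<comment> \<open>The kernel vanishes, so every element has zeroth coefficient \<open>0\<close> and any constant works.\<close>
    then have "?k = 0" using cinner_reproducing_kernel[OF k] by (intro cinner_definite) simp
    then have "cinner f (monomial 0) = 0" if "f \<in> model_space \<theta>" for f
      using cinner_reproducing_kernel[OF that] by simp
    then show ?thesis using U that[of 1] by simp
  next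
    case False
    then show ?thesis
      using rank_one by (intro that[of "cinner (U ?k) (monomial 0) / cinner ?k (monomial 0)"])
        (simp add: field_simps)
  qed
  have coeff: "cinner (U f) (monomial (int n)) = c * cinner f (monomial (int n))"
    if "f \<in> model_space \<theta>" for f n
    using that
  proof (induction n arbitrary: f)
    case 0
    then show ?case using c by simp
  next
    case (Suc n)
    have "cinner (U (backward_shift f)) (monomial (int n)) = c * cinner (backward_shift f) (monomial (int n))"
      by (rule Suc.IH[OF compressed_shift_adj_eq(2)[OF Suc.prems]])
    then show ?case
      by (simp add: B[OF Suc.prems] backward_shift_coeff add.commute)
  qed
  have "U f = c *\<^sub>C f" if f: "f \<in> model_space \<theta>" for f
  proof -
    have "cinner (U f - c *\<^sub>C f) (monomial n) = 0" for n
    proof (cases "n < 0")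
      case True
      then show ?thesis
        using f U[OF f] by (simp add: cinner_diff_left cinner_scaleC_left model_space_iff[OF inner])
    next
      case False
      then show ?thesis
        using coeff[OF f, of "nat n"] by (simp add: cinner_diff_left cinner_scaleC_left)
    qed
    then show ?thesis using monomials_complete by force
  qed
  then show ?thesis by blast
qed

end

theorem corollary3p6:
  fixes \<theta> :: "complex \<Rightarrow> complex" and X :: "l2 \<Rightarrow> l2"
  assumes "inner_function \<theta>"
  shows "(conjugation_on (model_space \<theta>) X \<and>
          (\<forall>f\<in>model_space \<theta>. compressed_shift_adj \<theta> (X f) = X (compressed_shift \<theta> f)) \<and>
          (\<forall>f\<in>model_space \<theta>. compressed_shift \<theta> (X f) = X (compressed_shift_adj \<theta> f)))
     \<longleftrightarrow> (\<exists>c. cmod c = 1 \<and> (\<forall>f\<in>model_space \<theta>. X f = c *\<^sub>C model_conj \<theta> f))"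
    (is "?L \<longleftrightarrow> ?R")
proof
  let ?K = "model_space \<theta>" and ?C = "model_conj \<theta>"
  note inner = assms
  note CK = model_conj_in_model_space[OF inner] and CC = model_conj_involutive[OF inner]
  note adj = compressed_shift_adj_eq[OF inner]
  {
    assume L: ?L
    then have XK: "X f \<in> ?K" if "f \<in> ?K" for f using that by (simp add: conjugation_on_def)
    have X_add: "X (f + g) = X f + X g" if "f \<in> ?K" "g \<in> ?K" for f g
      using L that by (simp add: conjugation_on_def)
    have X_scale: "X (a *\<^sub>C f) = cnj a *\<^sub>C X f" if "f \<in> ?K" for a f
      using L that by (simp add: conjugation_on_def)
    have X_cinner: "cinner (X f) (X g) = cinner g f" if "f \<in> ?K" "g \<in> ?K" for f g
      using L that by (simp add: conjugation_on_def)
    have "\<exists>c. \<forall>f\<in>?K. (\<lambda>f. X (?C f)) f = c *\<^sub>C f"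
    proof (rule commutant_scalar[OF inner])
      fix f g assume f: "f \<in> ?K"
      show "X (?C f) \<in> ?K" by (intro XK CK f)
      show "X (?C (f + g)) = X (?C f) + X (?C g)" if "g \<in> ?K"
        using that f by (simp add: model_conj_add[OF inner] X_add CK)
      show "X (?C (c *\<^sub>C f)) = c *\<^sub>C X (?C f)" for c
        using f by (simp add: model_conj_scaleC[OF inner] X_scale CK)
      show "X (?C (compressed_shift \<theta> f)) = compressed_shift \<theta> (X (?C f))"
        using L f CK[OF f] by (simp add: backward_shift_model_conj[OF inner, symmetric] adj)
      show "X (?C (backward_shift f)) = backward_shift (X (?C f))"
      proof -
        have "compressed_shift_adj \<theta> (X (?C f)) = X (compressed_shift \<theta> (?C f))"
          using L CK[OF f] by blast
        then show ?thesis
          by (simp add: adj(1)[OF XK[OF CK[OF f]]] compressed_shift_model_conj[OF inner f])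
      qed
    qed
    then obtain c where c: "\<And>f. f \<in> ?K \<Longrightarrow> X (?C f) = c *\<^sub>C f" by blast
    show ?R
    proof (cases "\<exists>f\<in>?K. f \<noteq> 0")
      case True
      then obtain f where f: "f \<in> ?K" "f \<noteq> 0" by blast
      have "cinner f f = cinner (X (?C f)) (X (?C f))"
        using f by (simp add: X_cinner CK cinner_model_conj[OF inner])
      also have "\<dots> = (c * cnj c) * cinner f f"
        by (simp add: c[OF f(1)] cinner_scaleC_left cinner_scaleC_right)
      finally have "c * cnj c = 1" using f(2) cinner_definite[of f] by auto
      then have "complex_of_real ((cmod c)\<^sup>2) = 1" by (simp only: complex_norm_square)
      then have "(cmod c)\<^sup>2 = 1" using of_real_eq_1_iff by blast
      then have "cmod c = 1 \<or> cmod c = - 1" by (simp only: power2_eq_1_iff)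
      then have "cmod c = 1" using norm_ge_zero[of c] by linarith
      moreover have "X g = c *\<^sub>C ?C g" if "g \<in> ?K" for g
        using c[OF CK[OF that]] by (simp add: CC)
      ultimately show ?thesis by blast
    next
      case False
      \<comment> \<open>On the zero space the scalar is arbitrary, but it still has to be unimodular.\<close>
      have "X f = 1 *\<^sub>C ?C f" if "f \<in> ?K" for f
      proof -
        have "X f = 0" "?C f = 0" using that False XK CK by blast+
        then show ?thesis by simp
      qed
      then show ?thesis by (intro exI[of _ 1]) simp
    qed
  next
    assume ?R
    then obtain c where c: "cmod c = 1" and X: "\<And>f. f \<in> ?K \<Longrightarrow> X f = c *\<^sub>C ?C f" by blast
    have cc: "c * cnj c = 1" using c by (simp add: complex_norm_square[symmetric])
    have XK: "X f \<in> ?K" if "f \<in> ?K" for f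
      using that by (simp add: X model_space_scaleC[OF inner] CK)
    have "conjugation_on ?K X"
      unfolding conjugation_on_def
    proof (intro conjI ballI allI)
      fix f assume f: "f \<in> ?K"
      show "X f \<in> ?K" by (rule XK[OF f])
      show "X (f + g) = X f + X g" if "g \<in> ?K" for g
        using f that by (simp add: X model_space_add[OF inner] model_conj_add[OF inner] scaleC_add_right)
      show "X (a *\<^sub>C f) = cnj a *\<^sub>C X f" for a
        using f by (simp add: X model_space_scaleC[OF inner] model_conj_scaleC[OF inner] scaleC_scaleC mult.commute)
      show "cinner (X f) (X g) = cinner g f" if "g \<in> ?K" for g
        using f that cc by (simp add: X cinner_scaleC_left cinner_scaleC_right cinner_model_conj[OF inner]
            mult.assoc[symmetric] mult.commute[of "cnj c" c])
      show "X (X f) = f"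
        using f cc by (simp add: X XK[unfolded X] model_space_scaleC[OF inner] CK model_conj_scaleC[OF inner]
            scaleC_scaleC CC scaleC_one)
    qed
    moreover have "compressed_shift_adj \<theta> (X f) = X (compressed_shift \<theta> f)" if f: "f \<in> ?K" for f
    proof -
      have "compressed_shift_adj \<theta> (X f) = backward_shift (c *\<^sub>C ?C f)"
        using adj(1)[OF XK[OF f]] by (simp add: X[OF f])
      also have "\<dots> = c *\<^sub>C backward_shift (?C f)" by (rule backward_shift_scaleC)
      also have "\<dots> = X (compressed_shift \<theta> f)"
        by (simp add: backward_shift_model_conj[OF inner f] X[OF compressed_shift_eq(2)[OF inner f]])
      finally show ?thesis .
    qed
    moreover have "compressed_shift \<theta> (X f) = X (compressed_shift_adj \<theta> f)" if f: "f \<in> ?K" for f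
    proof -
      have "compressed_shift \<theta> (X f) = c *\<^sub>C compressed_shift \<theta> (?C f)"
        unfolding X[OF f] by (rule compressed_shift_scaleC[OF inner CK[OF f]])
      also have "\<dots> = X (compressed_shift_adj \<theta> f)"
        by (simp add: compressed_shift_model_conj[OF inner f] adj(1)[OF f] X[OF adj(2)[OF f]])
      finally show ?thesis .
    qed
    ultimately show ?L by blast
  }
qed

end
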